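(* Let $k\ge 1$ be an integer, let $P$ be a $(k-1)$-dimensional polytope, let $p\in P$, and let $\mathcal{M}$ be a matroid of rank $k$ on a finite ground set $W$, with rank function $r$. For each nonempty face $\sigma\in F(P)$ and each element $w\in W$, let $y_\sigma^w\in \sigma$ be a point and let $A^w_\sigma\subseteq P$ be a closed set, such that the family $(A_\sigma^w \mid w\in W,\ \sigma\in F(P))$ is an $\mathcal{M}$-Komiya cover of $P$. Then there exist a basis $\{w_1,\dots, w_k\}$ of $\mathcal{M}$ and faces $\sigma_1,\dots,\sigma_k\in F(P)$ such that $\bigcap_{i=1}^k A^{w_i}_{\sigma_i} \neq \emptyset$ and $p\in \mathrm{conv}(\{y_{\sigma_1}^{w_1},\dots,y_{\sigma_k}^{w_k}\})$.
   Context: For a polytope $P$, $F(P)$ denotes the set of nonempty faces of $P$ (including $P$ itself). A family $(A_\sigma \mid \sigma\in F(P))$ of closed subsets of $P$ is a Komiya cover of $P$ if for every face $\tau\in F(P)$ one has $\tau\subseteq \bigcup_{\sigma\in F(P),\,\sigma\subseteq\tau} A_\sigma$. For a matroid $\mathcal{M}$ of rank $k$ on ground set $W$ with rank function $r$ ($r(A)$ = size of a largest independent subset of $A$), a family of closed subsets $(A_\sigma^w \mid w\in W,\ \sigma\in F(P))$ of a $(k-1)$-dimensional polytope $P$ is an $\mathcal{M}$-Komiya cover if for every $G\subseteq W$ with $r(W\setminus G)\le k-1$, the family $\left(\bigcup_{w\in G}A_\sigma^w \mid \sigma\in F(P)\right)$ is a Komiya cover of $P$. A basis of $\mathcal{M}$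 is an independent set of size $k$. *)

theory Defs
  imports "HOL-Analysis.Polytope"
begin

definition nonempty_faces :: "'a::euclidean_space set \<Rightarrow> 'a set set" where
  "nonempty_faces P = {\<sigma>. \<sigma> face_of P \<and> \<sigma> \<noteq> {}}"

definition komiya_cover ::
  "'a::euclidean_space set \<Rightarrow> ('a set \<Rightarrow> 'a set) \<Rightarrow> bool" where
  "komiya_cover P A \<longleftrightarrow>
     (\<forall>\<sigma>\<in>nonempty_faces P. closed (A \<sigma>) \<and> A \<sigma> \<subseteq> P) \<and>
     (\<forall>\<tau>\<in>nonempty_faces P. \<tau> \<subseteq> (\<Union>\<sigma>\<in>{\<sigma>\<in>nonempty_faces P. \<sigma> \<subseteq> \<tau>}. A \<sigma>))"

locale matroid =
  fixes W :: "'w set" and indep :: "'w set \<Rightarrow> bool"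
  assumes finite_ground: "finite W"
    and indep_subset_ground: "indep X \<Longrightarrow> X \<subseteq> W"
    and indep_empty: "indep {}"
    and indep_subset: "\<lbrakk>indep X; Y \<subseteq> X\<rbrakk> \<Longrightarrow> indep Y"
    and augmentation: "\<lbrakk>indep X; indep Y; card X < card Y\<rbrakk> \<Longrightarrow>
      \<exists>y\<in>Y - X. indep (insert y X)"

definition matroid_rank :: "('w set \<Rightarrow> bool) \<Rightarrow> 'w set \<Rightarrow> nat" where
  "matroid_rank indep A = Max (card ` {X. X \<subseteq> A \<and> indep X})"

definition matroid_basis :: "'w set \<Rightarrow> ('w set \<Rightarrow> bool) \<Rightarrow> 'w set \<Rightarrow> bool" where
  "matroid_basis W indep B \<longleftrightarrow> indep B \<and> card B = matroid_rank indep W"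

text \<open>The rank \<open>k\<close> of the matroid is \<open>matroid_rank indep W\<close>; the condition
  \<open>r(W - G) \<le> k - 1\<close> is stated over the integers to avoid truncated subtraction.\<close>

definition matroid_komiya_cover ::
  "'w set \<Rightarrow> ('w set \<Rightarrow> bool) \<Rightarrow> 'a::euclidean_space set \<Rightarrow> ('w \<Rightarrow> 'a set \<Rightarrow> 'a set) \<Rightarrow> bool"
where
  "matroid_komiya_cover W indep P A \<longleftrightarrow>
     (\<forall>w\<in>W. \<forall>\<sigma>\<in>nonempty_faces P. closed (A w \<sigma>) \<and> A w \<sigma> \<subseteq> P) \<and>
     (\<forall>G\<subseteq>W. int (matroid_rank indep (W - G)) \<le> int (matroid_rank indep W) - 1 \<longrightarrow>
        komiya_cover P (\<lambda>\<sigma>. \<Union>w\<in>G. A w \<sigma>))"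

end

theory Submission
  imports Defs "HOL-Library.Z2"
begin

text \<open>
  At every point of a face \<open>\<tau>\<close>, the colors \<open>w\<close> of the sets \<open>A w \<sigma>\<close> with \<open>\<sigma> \<subseteq> \<tau>\<close> containing
  that point span the matroid. Take a fine triangulation of \<open>P\<close>, and give each of its simplices the
  independence complex on the labels \<open>(w, \<sigma>)\<close> available at its vertices. The independence complex
  of a matroid of rank \<open>k\<close> has no reduced homology modulo 2 below dimension \<open>k - 1\<close>, so there is a
  chain map \<open>\<phi>\<close> from the triangulation subordinate to these complexes. After sending the label
  \<open>(w, \<sigma>)\<close> to \<open>y w \<sigma>\<close>, the map \<open>\<phi>\<close> respects the faces of \<open>P\<close>, so it is chain homotopic to the
  identity relative to the faces. The number of simplices of a chain whose hull contains a generic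
  point \<open>q\<close> is even for boundaries, and odd for the triangulation itself; hence it is odd for
  its image under \<open>\<phi>\<close>, which yields independent labels with \<open>q\<close> in the hull of their points.
  Refining the triangulation and letting \<open>q\<close> tend to \<open>p\<close> gives the theorem by compactness.
\<close>

subsection \<open>Chains modulo 2 and matroid complexes\<close>

text \<open>The removed rule turns sums of bits into conditionals, out of reach of the ring laws.\<close>

declare add_bit_eq_xor [simp del]

text \<open>A chain assigns a coefficient to vertex sets of all sizes at once, and the empty set
  counts as a simplex. This is therefore the boundary of the augmented complex, and acyclicity below
  means vanishing of reduced homology.\<close>

definition chain_boundary :: "'v set \<Rightarrow> ('v set \<Rightarrow> bit) \<Rightarrow> 'v set \<Rightarrow> bit" where
  "chain_boundary V c G = (\<Sum>x\<in>V - G. c (insert x G))"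

text \<open>The join with the apex \<open>e\<close>: a simplex avoiding \<open>e\<close> gains this
  vertex, and a simplex containing \<open>e\<close> is sent to zero.\<close>

definition chain_cone :: "'v \<Rightarrow> ('v set \<Rightarrow> bit) \<Rightarrow> 'v set \<Rightarrow> bit" where
  "chain_cone e c F = (if e \<in> F then c (F - {e}) else 0)"

lemma bit_add_self: "(b::bit) + b = 0"
  by (cases b) simp_all

text \<open>The terms for \<open>(x, y)\<close> and \<open>(y, x)\<close> cancel modulo 2. This is
  the cancellation behind every statement that a boundary is a cycle.\<close>

lemma sum_symmetric_pairs_bit:
  fixes f :: "'v \<Rightarrow> 'v \<Rightarrow> bit"
  assumes "finite A" and "\<And>x y. x \<in> A \<Longrightarrow> y \<in> A \<Longrightarrow> x \<noteq> y \<Longrightarrow> f x y = f y x"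
  shows "(\<Sum>x\<in>A. \<Sum>y\<in>A - {x}. f x y) = 0"
  using assms
proof (induction A rule: finite_induct)
  case (insert a A)
  have "(\<Sum>x\<in>A. \<Sum>y\<in>insert a A - {x}. f x y) = (\<Sum>x\<in>A. f x a + (\<Sum>y\<in>A - {x}. f x y))"
  proof (rule sum.cong[OF refl])
    fix x assume "x \<in> A"
    then have "insert a A - {x} = insert a (A - {x})" "a \<notin> A - {x}"
      using insert by auto
    then show "(\<Sum>y\<in>insert a A - {x}. f x y) = f x a + (\<Sum>y\<in>A - {x}. f x y)"
      using insert by simp
  qed
  also have "\<dots> = (\<Sum>x\<in>A. f x a)"
    using insert by (simp add: sum.distrib)
  also have "\<dots> = (\<Sum>x\<in>A. f a x)"
    using insert by (intro sum.cong) auto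
  finally show ?case
    using insert by (simp add: bit_add_self)
qed simp

lemma chain_boundary_boundary:
  assumes "finite V"
  shows "chain_boundary V (chain_boundary V c) G = 0"
proof -
  have "chain_boundary V (chain_boundary V c) G =
      (\<Sum>x\<in>V - G. \<Sum>y\<in>V - G - {x}. c (insert y (insert x G)))"
    unfolding chain_boundary_def by (intro sum.cong) auto
  also have "\<dots> = 0"
    using assms by (intro sum_symmetric_pairs_bit) (auto simp: insert_commute)
  finally show ?thesis .
qed

lemma chain_boundary_add:
  "chain_boundary V (\<lambda>F. c F + d F) G = chain_boundary V c G + chain_boundary V d G"
  by (simp add: chain_boundary_def sum.distrib)

lemma chain_boundary_sum:
  "chain_boundary V (\<lambda>F. \<Sum>i\<in>I. c i F) G = (\<Sum>i\<in>I. chain_boundary V (c i) G)"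
  unfolding chain_boundary_def by (rule sum.swap)

text \<open>The cone operator is a contracting homotopy of the full simplex on \<open>V\<close>, so
  that every cycle is the boundary of its cone. If \<open>e\<close> lies in \<open>G\<close>, the
  term for \<open>x = e\<close> in the boundary of \<open>c\<close> at \<open>G - {e}\<close> is
  \<open>c G\<close>, which cancels the other summand.\<close>

lemma chain_boundary_cone:
  assumes "finite V" "e \<in> V"
  shows "chain_boundary V (chain_cone e c) G = c G + chain_cone e (chain_boundary V c) G"
proof (cases "e \<in> G")
  case False
  have "chain_boundary V (chain_cone e c) G = (\<Sum>x\<in>V - G. if x = e then c G else 0)"
    unfolding chain_boundary_def using False
    by (intro sum.cong) (auto simp: chain_cone_def)
  then show ?thesis
    using False assms by (simp add: chain_cone_def)
next
  case True
  have "V - (G - {e}) = insert e (V - G)" "insert e (G - {e}) = G"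
    using True assms by auto
  then have "chain_boundary V c (G - {e}) = c G + (\<Sum>x\<in>V - G. c (insert x (G - {e})))"
    unfolding chain_boundary_def using assms True by simp
  moreover have "chain_boundary V (chain_cone e c) G = (\<Sum>x\<in>V - G. c (insert x (G - {e})))"
    unfolding chain_boundary_def chain_cone_def using True
    by (intro sum.cong) (auto simp: insert_Diff_if)
  ultimately show ?thesis
    using True by (simp add: chain_cone_def add.assoc[symmetric] bit_add_self)
qed

section \<open>Acyclicity of the independence complex of a matroid\<close>

lemma (in matroid) finite_indep: "indep X \<Longrightarrow> finite X"
  using indep_subset_ground finite_ground finite_subset by blast

lemma (in matroid) matroid_deletion: "matroid (W - {e}) (\<lambda>X. e \<notin> X \<and> indep X)"
proof
  show "\<exists>y\<in>Y - X. e \<notin> insert y X \<and> indep (insert y X)"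
    if "e \<notin> X \<and> indep X" "e \<notin> Y \<and> indep Y" "card X < card Y" for X Y
    using augmentation[of X Y] that by auto
qed (use finite_ground indep_subset_ground indep_empty indep_subset in auto)

lemma (in matroid) matroid_contraction:
  assumes "indep {e}"
  shows "matroid (W - {e}) (\<lambda>X. e \<notin> X \<and> indep (insert e X))"
proof
  show "\<exists>y\<in>Y - X. e \<notin> insert y X \<and> indep (insert e (insert y X))"
    if XY: "e \<notin> X \<and> indep (insert e X)" "e \<notin> Y \<and> indep (insert e Y)" "card X < card Y" for X Y
  proof -
    have "card (insert e X) < card (insert e Y)"
      using XY finite_indep[of "insert e X"] finite_indep[of "insert e Y"] by simp
    then obtain y where "y \<in> insert e Y - insert e X" "indep (insert y (insert e X))"
      using augmentation[of "insert e X" "insert e Y"] XY(1,2) by blast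
    then have "y \<in> Y - X" "e \<notin> insert y X" "indep (insert e (insert y X))"
      using XY(1) by (auto simp: insert_commute[of e y])
    then show ?thesis
      by blast
  qed
  show "e \<notin> Y \<and> indep (insert e Y)" if "e \<notin> X \<and> indep (insert e X)" "Y \<subseteq> X" for X Y
    using that indep_subset[of "insert e X" "insert e Y"] by auto
qed (use finite_ground indep_subset_ground assms in auto)

text \<open>Induction on the ground set by deletion and contraction of an element \<open>e\<close>
  of \<open>B\<close>. The sets of \<open>z\<close> through \<open>e\<close> form a cycle in the
  link of \<open>e\<close>, which is the independence complex of the contraction. A filling there,
  coned from \<open>e\<close>, makes \<open>z\<close> homologous to a cycle avoiding
  \<open>e\<close>, which lives in the deletion. It is filled by induction if the deletion still has
  independent sets of size \<open>d + 1\<close>, and by the cone from \<open>e\<close>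
  otherwise.\<close>

lemma matroid_complex_acyclic:
  assumes "matroid S ind" "finite V" "S \<subseteq> V"
    and "ind B" "card B = Suc d"
    and "\<And>X. z X \<noteq> 0 \<Longrightarrow> ind X \<and> card X = d"
    and "\<And>G. chain_boundary V z G = 0"
  shows "\<exists>c. (\<forall>X. c X \<noteq> 0 \<longrightarrow> ind X \<and> card X = Suc d) \<and> (\<forall>G. chain_boundary V c G = z G)"
  using assms
proof (induction "card S" arbitrary: S ind B d z rule: less_induct)
  case less
  interpret matroid S ind by (rule less.prems(1))
  obtain e where "e \<in> B"
    using less.prems(5) by (metis card_eq_0_iff ex_in_conv old.nat.distinct(1))
  have ind_e: "ind {e}"
    using indep_subset[OF less.prems(4)] \<open>e \<in> B\<close> by simp
  have eS: "e \<in> S"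
    using indep_subset_ground[OF ind_e] by simp
  then have eV: "e \<in> V"
    using less.prems(3) by auto
  have smaller: "card (S - {e}) < card S" "S - {e} \<subseteq> V"
    using eS finite_ground less.prems(3) card_gt_0_iff[of S] by auto
  have z_card: "ind X" "card X = d" if "z X = 1" for X
    using less.prems(6)[of X] that by auto
  show ?case
  proof (cases d)
    \<comment> \<open>The chain \<open>z\<close> is a multiple of the empty simplex, and its cone is
      the same multiple of the vertex \<open>e\<close>.\<close>
    case 0
    show ?thesis
    proof (intro exI conjI allI impI)
      fix X assume X: "chain_cone e z X \<noteq> 0"
      then have "e \<in> X" "z (X - {e}) = 1"
        by (auto simp: chain_cone_def split: if_splits)
      then have "X - {e} = {}"
        using z_card[of "X - {e}"] finite_indep[of "X - {e}"] 0 by (metis card_0_eq)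
      then have "X = {e}"
        using \<open>e \<in> X\<close> by auto
      then show "ind X" "card X = Suc d"
        using ind_e 0 by auto
    next
      fix G show "chain_boundary V (chain_cone e z) G = z G"
        using chain_boundary_cone[OF less.prems(2) eV] less.prems(7) by (simp add: chain_cone_def)
    qed
  next
    case (Suc d')
    let ?ind1 = "\<lambda>X. e \<notin> X \<and> ind (insert e X)"
    let ?ind0 = "\<lambda>X. e \<notin> X \<and> ind X"
    \<comment> \<open>The trace of \<open>z\<close> in the link of \<open>e\<close>. Its boundary at
      a set \<open>G\<close> avoiding \<open>e\<close> is the boundary of \<open>z\<close> at
      \<open>insert e G\<close>, so it is a cycle.\<close>
    define z1 where "z1 X = (if e \<in> X then 0 else z (insert e X))" for X
    have "\<exists>c. (\<forall>X. c X \<noteq> 0 \<longrightarrow> ?ind1 X \<and> card X = Suc d') \<and> (\<forall>G. chain_boundary V c G = z1 G)"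
    proof (rule less.hyps[OF smaller(1) matroid_contraction[OF ind_e] less.prems(2) smaller(2)])
      show "e \<notin> B - {e} \<and> ind (insert e (B - {e}))"
        using \<open>e \<in> B\<close> less.prems(4) by (simp add: insert_absorb)
      show "card (B - {e}) = Suc d'"
        using \<open>e \<in> B\<close> less.prems(5) Suc by simp
      show "(e \<notin> X \<and> ind (insert e X)) \<and> card X = d'" if "z1 X \<noteq> 0" for X
      proof -
        have "e \<notin> X" "z (insert e X) = 1"
          using that by (auto simp: z1_def split: if_splits)
        then show ?thesis
          using z_card[of "insert e X"] finite_indep[of "insert e X"] Suc by auto
      qed
      show "chain_boundary V z1 G = 0" for G
      proof (cases "e \<in> G")
        case True
        then show ?thesis by (simp add: chain_boundary_def z1_def)
      next
        case False
        then have "V - G = insert e (V - insert e G)"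
          using eV by auto
        then have "chain_boundary V z1 G = (\<Sum>x\<in>insert e (V - insert e G). z1 (insert x G))"
          unfolding chain_boundary_def by (rule arg_cong)
        also have "\<dots> = (\<Sum>x\<in>V - insert e G. z (insert x (insert e G)))"
        proof -
          have "z1 (insert e G) = 0"
            by (simp add: z1_def)
          moreover have "z1 (insert x G) = z (insert x (insert e G))" if "x \<in> V - insert e G" for x
            using that False by (auto simp: z1_def insert_commute[of e x])
          ultimately show ?thesis
            using less.prems(2) by (auto intro: sum.cong)
        qed
        also have "\<dots> = 0"
          using less.prems(7)[of "insert e G"] by (simp add: chain_boundary_def)
        finally show ?thesis .
      qed
    qed
    then obtain c1 where c1: "\<And>X. c1 X \<noteq> 0 \<Longrightarrow> ?ind1 X \<and> card X = d"
        and bc1: "\<And>G. chain_boundary V c1 G = z1 G"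
      using Suc by blast
    \<comment> \<open>On sets containing \<open>e\<close>, the boundary of the cone over
      \<open>c1\<close> agrees with \<open>z\<close>; adding it leaves a cycle supported on sets
      without \<open>e\<close>.\<close>
    define z' where "z' X = z X + chain_boundary V (chain_cone e c1) X" for X
    have z'_eq: "z' X = (if e \<in> X then 0 else z X + c1 X)" for X
    proof (cases "e \<in> X")
      case True
      then have "c1 X = 0"
        using c1[of X] by (cases "c1 X") auto
      then show ?thesis
        using True unfolding z'_def chain_boundary_cone[OF less.prems(2) eV]
        by (simp add: chain_cone_def bc1 z1_def insert_absorb bit_add_self)
    next
      case False
      then show ?thesis
        unfolding z'_def chain_boundary_cone[OF less.prems(2) eV] by (simp add: chain_cone_def)
    qed
    have z'_supp: "?ind0 X \<and> card X = d" if "z' X \<noteq> 0" for X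
    proof -
      have "e \<notin> X" and "z X + c1 X \<noteq> 0"
        using that by (auto simp: z'_eq split: if_splits)
      then consider "z X = 1" | "c1 X = 1"
        by (cases "z X"; cases "c1 X") auto
      then show ?thesis
      proof cases
        case 1
        then show ?thesis using z_card \<open>e \<notin> X\<close> by auto
      next
        case 2
        then show ?thesis
          using c1[of X] indep_subset[of "insert e X" X] by auto
      qed
    qed
    have bz': "chain_boundary V z' G = 0" for G
      unfolding z'_def chain_boundary_add
      using less.prems(7) chain_boundary_boundary[OF less.prems(2)] by simp
    have cone_c1: "ind X \<and> card X = Suc d" if "chain_cone e c1 X \<noteq> 0" for X
    proof -
      have "e \<in> X" "c1 (X - {e}) \<noteq> 0"
        using that by (auto simp: chain_cone_def split: if_splits)
      then show ?thesis
        using c1[of "X - {e}"] finite_indep[of X] card_Suc_Diff1[of X e] by (auto simp: insert_absorb)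
    qed
    have "\<exists>c0. (\<forall>X. c0 X \<noteq> 0 \<longrightarrow> ind X \<and> card X = Suc d) \<and> (\<forall>G. chain_boundary V c0 G = z' G)"
    proof (cases "\<exists>B'. ?ind0 B' \<and> card B' = Suc d")
      case True
      then obtain B' where B': "?ind0 B'" "card B' = Suc d"
        by blast
      show ?thesis
        using less.hyps[OF smaller(1) matroid_deletion less.prems(2) smaller(2) B' z'_supp bz'] by blast
    next
      case False
      show ?thesis
      proof (intro exI conjI allI impI)
        fix G show "chain_boundary V (chain_cone e z') G = z' G"
          using chain_boundary_cone[OF less.prems(2) eV] bz' by (simp add: chain_cone_def)
      next
        fix X assume "chain_cone e z' X \<noteq> 0"
        then have X: "e \<in> X" "z' (X - {e}) \<noteq> 0"
          by (auto simp: chain_cone_def split: if_splits)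
        then have X': "ind (X - {e})" "card (X - {e}) = d"
          using z'_supp[of "X - {e}"] by auto
        \<comment> \<open>An augmenting element other than \<open>e\<close> would give an independent set of size
          \<open>d + 1\<close> avoiding \<open>e\<close>.\<close>
        then obtain b where b: "b \<in> B - (X - {e})" "ind (insert b (X - {e}))"
          using augmentation[of "X - {e}" B] less.prems(4,5) by auto
        have card_b: "card (insert b (X - {e})) = Suc d"
          using b X' finite_indep[of "X - {e}"] by simp
        have "b = e"
        proof (rule ccontr)
          assume "b \<noteq> e"
          then have "?ind0 (insert b (X - {e})) \<and> card (insert b (X - {e})) = Suc d"
            using b(2) card_b by simp
          then have "\<exists>B'. ?ind0 B' \<and> card B' = Suc d"
            by (rule exI)
          with False show False
            by (rule notE)
        qed
        then show "ind X" "card X = Suc d"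
          using b(2) card_b X(1) by (simp_all add: insert_absorb)
      qed
    qed
    then obtain c0 where c0: "\<And>X. c0 X \<noteq> 0 \<Longrightarrow> ind X \<and> card X = Suc d"
        and bc0: "\<And>G. chain_boundary V c0 G = z' G"
      by blast
    show ?thesis
    proof (intro exI[of _ "\<lambda>X. c0 X + chain_cone e c1 X"] conjI allI)
      fix X
      show "c0 X + chain_cone e c1 X \<noteq> 0 \<longrightarrow> ind X \<and> card X = Suc d"
        using c0[of X] cone_c1[of X] by (metis add_0)
      show "chain_boundary V (\<lambda>X. c0 X + chain_cone e c1 X) X = z X"
        unfolding chain_boundary_add bc0 z'_def by (simp add: add.assoc bit_add_self)
    qed
  qed
qed

section \<open>Chain maps and homotopies subordinate to a carrier\<close>

text \<open>The method of acyclic carriers, by induction on the number of vertices: the images of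
  the facets of \<open>F\<close> add up to a cycle, which lies in the carrier \<open>K F\<close> by
  monotonicity and can be filled there. Since \<open>\<phi>\<close> fixes the empty simplex, it
  preserves the augmentation.\<close>

lemma acyclic_carrier_chain_map:
  assumes "finite V"
    and fin: "\<And>F. F \<in> \<K> \<Longrightarrow> finite F"
    and closed: "\<And>F v. F \<in> \<K> \<Longrightarrow> v \<in> F \<Longrightarrow> F - {v} \<in> \<K>"
    and empty: "K {} {}"
    and mono: "\<And>F v X. F \<in> \<K> \<Longrightarrow> v \<in> F \<Longrightarrow> K (F - {v}) X \<Longrightarrow> K F X"
    and acyclic: "\<And>F d z. F \<in> \<K> \<Longrightarrow> card F = Suc d \<Longrightarrow>
        (\<And>X. z X \<noteq> 0 \<Longrightarrow> K F X \<and> card X = d) \<Longrightarrow> (\<And>G. chain_boundary V z G = 0) \<Longrightarrow>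
        \<exists>c. (\<forall>X. c X \<noteq> 0 \<longrightarrow> K F X \<and> card X = Suc d) \<and> (\<forall>G. chain_boundary V c G = z G)"
  obtains \<phi> :: "'s set \<Rightarrow> 'v set \<Rightarrow> bit" where "\<And>X. \<phi> {} X = of_bool (X = {})"
    and "\<And>F X. F \<in> \<K> \<Longrightarrow> \<phi> F X \<noteq> 0 \<Longrightarrow> K F X \<and> card X = card F"
    and "\<And>F G. F \<in> \<K> \<Longrightarrow> chain_boundary V (\<phi> F) G = (\<Sum>v\<in>F. \<phi> (F - {v}) G)"
proof -
  define good where "good F c z \<longleftrightarrow> (\<forall>X. c X \<noteq> 0 \<longrightarrow> K F X \<and> card X = card F) \<and>
     (\<forall>G. chain_boundary V c G = z G)" for F c z
  \<comment> \<open>\<open>\<Phi> n\<close> is meant for simplices with \<open>n\<close> vertices.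
    The truncated \<open>n - 1\<close> in the invariant below is harmless, because at
    \<open>n = 0\<close> the sum over the vertices is empty.\<close>
  define \<Phi> :: "nat \<Rightarrow> 's set \<Rightarrow> 'v set \<Rightarrow> bit" where
    "\<Phi> = rec_nat (\<lambda>F X. of_bool (X = {})) (\<lambda>n g F. SOME c. good F c (\<lambda>X. \<Sum>v\<in>F. g (F - {v}) X))"
  have \<Phi>0: "\<Phi> 0 F X = of_bool (X = {})" for F X
    by (simp add: \<Phi>_def)
  have \<Phi>S: "\<Phi> (Suc n) F = (SOME c. good F c (\<lambda>X. \<Sum>v\<in>F. \<Phi> n (F - {v}) X))" for n F
    by (simp add: \<Phi>_def)
  have good: "good F (\<Phi> n F) (\<lambda>X. \<Sum>v\<in>F. \<Phi> (n - 1) (F - {v}) X)" if "F \<in> \<K>" "card F = n" for n F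
    using that
  proof (induction n arbitrary: F)
    case 0
    then have "F = {}"
      using fin by auto
    then show ?case
      using empty by (auto simp: good_def \<Phi>0 chain_boundary_def)
  next
    case (Suc n)
    let ?z = "\<lambda>X. \<Sum>v\<in>F. \<Phi> n (F - {v}) X"
    have sub: "F - {v} \<in> \<K>" "card (F - {v}) = n" if "v \<in> F" for v
      using that Suc.prems closed fin by auto
    have "\<exists>c. good F c ?z"
      unfolding good_def Suc.prems(2)
    proof (rule acyclic[OF Suc.prems])
      show "K F X \<and> card X = n" if nz: "?z X \<noteq> 0" for X
      proof -
        obtain v where v: "v \<in> F" "\<Phi> n (F - {v}) X \<noteq> 0"
          using nz by (rule sum.not_neutral_contains_not_neutral)
        then show ?thesis
          using Suc.IH[OF sub[OF v(1)]] sub[OF v(1)] mono[OF Suc.prems(1) v(1)] unfolding good_def by auto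
      qed
      show "chain_boundary V ?z G = 0" for G
      proof -
        have "chain_boundary V ?z G = (\<Sum>v\<in>F. \<Sum>u\<in>F - {v}. \<Phi> (n - 1) (F - {v} - {u}) G)"
          unfolding chain_boundary_sum using Suc.IH[OF sub] by (intro sum.cong) (auto simp: good_def)
        also have "\<dots> = 0"
        proof (rule sum_symmetric_pairs_bit)
          show "\<Phi> (n - 1) (F - {x} - {y}) G = \<Phi> (n - 1) (F - {y} - {x}) G" for x y
            by (simp add: Diff_insert2[symmetric] insert_commute)
        qed (use fin Suc.prems in auto)
        finally show ?thesis .
      qed
    qed
    then show ?case
      unfolding \<Phi>S diff_Suc_1 by (rule someI_ex)
  qed
  show thesis
  proof (rule that[of "\<lambda>F. \<Phi> (card F) F"])
    show "\<Phi> (card {}) {} X = of_bool (X = {})" for X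
      by (simp add: \<Phi>0)
    show "K F X \<and> card X = card F" if "F \<in> \<K>" "\<Phi> (card F) F X \<noteq> 0" for F X
      using good[OF that(1) refl] that(2) unfolding good_def by blast
    show "chain_boundary V (\<Phi> (card F) F) G = (\<Sum>v\<in>F. \<Phi> (card (F - {v})) (F - {v}) G)"
      if "F \<in> \<K>" for F G
      using good[OF that refl] fin[OF that] unfolding good_def by simp
  qed
qed

text \<open>Here the carrier of \<open>F\<close> consists of all finite subsets of
  \<open>M F\<close>. Such a full simplex is a cone from any of its vertices, so the homotopy can be
  written down: cone the cycle formed by \<open>\<theta> F\<close> and the homotopies already chosen
  on the facets of \<open>F\<close> from a point of \<open>M F\<close>.\<close>

lemma chain_null_homotopy:
  fixes \<theta> :: "'s set \<Rightarrow> 'v set \<Rightarrow> bit"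
  assumes "finite V"
    and fin: "\<And>F. F \<in> \<K> \<Longrightarrow> finite F"
    and closed: "\<And>F v. F \<in> \<K> \<Longrightarrow> v \<in> F \<Longrightarrow> F - {v} \<in> \<K>"
    and M: "\<And>F. F \<in> \<K> \<Longrightarrow> F \<noteq> {} \<Longrightarrow> M F \<inter> V \<noteq> {}"
    and mono: "\<And>F v. F \<in> \<K> \<Longrightarrow> v \<in> F \<Longrightarrow> M (F - {v}) \<subseteq> M F"
    and \<theta>_empty: "\<And>X. \<theta> {} X = 0"
    and \<theta>_supp: "\<And>F X. F \<in> \<K> \<Longrightarrow> \<theta> F X \<noteq> 0 \<Longrightarrow> finite X \<and> X \<subseteq> M F \<and> card X = card F"
    and \<theta>_bd: "\<And>F G. F \<in> \<K> \<Longrightarrow> chain_boundary V (\<theta> F) G = (\<Sum>v\<in>F. \<theta> (F - {v}) G)"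
  obtains h :: "'s set \<Rightarrow> 'v set \<Rightarrow> bit" where "\<And>X. h {} X = 0"
    and "\<And>F X. F \<in> \<K> \<Longrightarrow> h F X \<noteq> 0 \<Longrightarrow> finite X \<and> X \<subseteq> M F \<and> card X = Suc (card F)"
    and "\<And>F G. F \<in> \<K> \<Longrightarrow> chain_boundary V (h F) G = \<theta> F G + (\<Sum>v\<in>F. h (F - {v}) G)"
proof -
  define a where "a F = (SOME a. a \<in> M F \<inter> V)" for F
  have a: "a F \<in> M F" "a F \<in> V" if "F \<in> \<K>" "F \<noteq> {}" for F
    using someI_ex[of "\<lambda>a. a \<in> M F \<inter> V"] M[OF that] unfolding a_def by auto
  define H :: "nat \<Rightarrow> 's set \<Rightarrow> 'v set \<Rightarrow> bit" where
    "H = rec_nat (\<lambda>F X. 0) (\<lambda>n g F. chain_cone (a F) (\<lambda>X. \<theta> F X + (\<Sum>v\<in>F. g (F - {v}) X)))"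
  have H0: "H 0 F X = 0" for F X
    by (simp add: H_def)
  have HS: "H (Suc n) F = chain_cone (a F) (\<lambda>X. \<theta> F X + (\<Sum>v\<in>F. H n (F - {v}) X))" for n F
    by (simp add: H_def)
  have good: "(\<forall>X. H n F X \<noteq> 0 \<longrightarrow> finite X \<and> X \<subseteq> M F \<and> card X = Suc (card F)) \<and>
     (\<forall>G. chain_boundary V (H n F) G = \<theta> F G + (\<Sum>v\<in>F. H (n - 1) (F - {v}) G))"
    if "F \<in> \<K>" "card F = n" for n F
    using that
  proof (induction n arbitrary: F)
    case 0
    then have "F = {}"
      using fin by auto
    then show ?case
      by (simp add: H0 \<theta>_empty chain_boundary_def)
  next
    case (Suc n)
    have "F \<noteq> {}" using Suc.prems by auto
    note aF = a[OF Suc.prems(1) this]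
    have sub: "F - {v} \<in> \<K>" "card (F - {v}) = n" if "v \<in> F" for v
      using that Suc.prems closed fin by auto
    let ?z = "\<lambda>X. \<theta> F X + (\<Sum>v\<in>F. H n (F - {v}) X)"
    have supp: "finite X \<and> X \<subseteq> M F \<and> card X = Suc n" if nz: "?z X \<noteq> 0" for X
    proof (cases "\<theta> F X = 0")
      case True
      then have "(\<Sum>v\<in>F. H n (F - {v}) X) \<noteq> 0"
        using nz by simp
      then obtain v where v: "v \<in> F" "H n (F - {v}) X \<noteq> 0"
        by (rule sum.not_neutral_contains_not_neutral)
      then show ?thesis
        using Suc.IH[OF sub[OF v(1)]] sub[OF v(1)] mono[OF Suc.prems(1) v(1)] by auto
    next
      case False
      then show ?thesis
        using \<theta>_supp Suc.prems by auto
    qed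
    have bd: "chain_boundary V ?z G = 0" for G
    proof -
      have "(\<Sum>v\<in>F. chain_boundary V (H n (F - {v})) G) =
          (\<Sum>v\<in>F. \<theta> (F - {v}) G) + (\<Sum>v\<in>F. \<Sum>u\<in>F - {v}. H (n - 1) (F - {v} - {u}) G)"
        unfolding sum.distrib[symmetric] using Suc.IH[OF sub] by (intro sum.cong) auto
      also have "(\<Sum>v\<in>F. \<Sum>u\<in>F - {v}. H (n - 1) (F - {v} - {u}) G) = 0"
      proof (rule sum_symmetric_pairs_bit)
        show "H (n - 1) (F - {x} - {y}) G = H (n - 1) (F - {y} - {x}) G" for x y
          by (simp add: Diff_insert2[symmetric] insert_commute)
      qed (use fin Suc.prems in auto)
      finally show ?thesis
        unfolding chain_boundary_add chain_boundary_sum by (simp add: \<theta>_bd Suc.prems bit_add_self)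
    qed
    show ?case
    proof (intro conjI allI)
      fix X
      show "H (Suc n) F X \<noteq> 0 \<longrightarrow> finite X \<and> X \<subseteq> M F \<and> card X = Suc (card F)"
      proof
        assume "H (Suc n) F X \<noteq> 0"
        then have "a F \<in> X" "?z (X - {a F}) \<noteq> 0"
          by (auto simp: HS chain_cone_def split: if_splits)
        then show "finite X \<and> X \<subseteq> M F \<and> card X = Suc (card F)"
          using supp[of "X - {a F}"] card_Suc_Diff1[of X "a F"] aF Suc.prems by auto
      qed
      show "chain_boundary V (H (Suc n) F) X = \<theta> F X + (\<Sum>v\<in>F. H (Suc n - 1) (F - {v}) X)"
        unfolding HS chain_boundary_cone[OF assms(1) aF(2)] using bd by (simp add: chain_cone_def)
    qed
  qed
  show thesis
  proof (rule that[of "\<lambda>F. H (card F) F"])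
    show "H (card {}) {} X = 0" for X
      by (simp add: H0)
    show "finite X \<and> X \<subseteq> M F \<and> card X = Suc (card F)" if "F \<in> \<K>" "H (card F) F X \<noteq> 0" for F X
      using good[OF that(1) refl] that(2) by blast
    show "chain_boundary V (H (card F) F) G = \<theta> F G + (\<Sum>v\<in>F. H (card (F - {v})) (F - {v}) G)"
      if "F \<in> \<K>" for F G
      using good[OF that refl] fin[OF that] by simp
  qed
qed

subsection \<open>Triangulations of polytopes\<close>

lemma mem_hull_subset_affine_independent:
  fixes C :: "'a::euclidean_space set"
  assumes "\<not> affine_dependent C" "D \<subseteq> C" "x \<in> C" "x \<in> convex hull D"
  shows "x \<in> D"
proof (rule ccontr)
  assume "x \<notin> D"
  then have "D \<subseteq> C - {x}"
    using assms(2) by auto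
  then have "convex hull D \<subseteq> affine hull (C - {x})"
    using convex_hull_subset_affine_hull[of D] hull_mono[of D "C - {x}" affine] by auto
  then show False
    using assms by (auto simp: affine_dependent_def)
qed

text \<open>A face of a simplex is spanned by some of its vertices, and these are exactly the
  extreme points of the face. Seen from either simplex, the common face thus has the same
  vertices.\<close>

lemma affine_independent_inter_hulls:
  fixes C D :: "'a::euclidean_space set"
  assumes "\<not> affine_dependent C" "\<not> affine_dependent D"
    and "(convex hull C \<inter> convex hull D) face_of (convex hull C)"
    and "(convex hull C \<inter> convex hull D) face_of (convex hull D)"
  shows "convex hull C \<inter> convex hull D = convex hull (C \<inter> D)"
proof -
  obtain c where c: "c \<subseteq> C" "convex hull C \<inter> convex hull D = convex hull c"
    using assms(1,3) face_of_convex_hull_affine_independent by blast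
  obtain d where d: "d \<subseteq> D" "convex hull C \<inter> convex hull D = convex hull d"
    using assms(2,4) face_of_convex_hull_affine_independent by blast
  have ind: "\<not> affine_dependent c" "\<not> affine_dependent d"
    using c(1) d(1) assms(1,2) affine_dependent_subset by blast+
  have "c = {x. x extreme_point_of (convex hull c)}"
    using extreme_point_of_convex_hull_affine_independent[OF ind(1)] by auto
  also have "\<dots> = {x. x extreme_point_of (convex hull d)}"
    using c(2) d(2) by simp
  also have "\<dots> = d"
    using extreme_point_of_convex_hull_affine_independent[OF ind(2)] by auto
  finally have "c \<subseteq> C \<inter> D"
    using c(1) d(1) by auto
  then have "convex hull c \<subseteq> convex hull (C \<inter> D)"
    by (rule hull_mono)
  moreover have "convex hull (C \<inter> D) \<subseteq> convex hull C \<inter> convex hull D"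
    by (simp add: hull_mono)
  ultimately show ?thesis
    using c(2) by auto
qed

text \<open>Only the simplices of full dimension are recorded, each by its vertex set.
  \<open>hull_Int\<close> says that they meet face to face; in particular, simplices without common
  vertices are disjoint.\<close>

locale simplex_triangulation =
  fixes P :: "'a::euclidean_space set" and k :: nat and \<C> :: "'a set set"
  assumes polytope_P: "polytope P"
    and aff_dim_P: "aff_dim P = int k - 1"
    and finite_simplices: "finite \<C>"
    and indep_simplex: "C \<in> \<C> \<Longrightarrow> \<not> affine_dependent C"
    and card_simplex: "C \<in> \<C> \<Longrightarrow> card C = k"
    and simplices_cover: "(\<Union>C\<in>\<C>. convex hull C) = P"
    and hull_Int: "\<lbrakk>C \<in> \<C>; D \<in> \<C>\<rbrakk> \<Longrightarrow> convex hull C \<inter> convex hull D = convex hull (C \<inter> D)"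

lemma polytope_fine_triangulation:
  fixes P :: "'a::euclidean_space set"
  assumes "polytope P" "aff_dim P = int k - 1" "0 < e"
  obtains \<C> where "simplex_triangulation P k \<C>"
    and "\<And>C x y. C \<in> \<C> \<Longrightarrow> x \<in> C \<Longrightarrow> y \<in> C \<Longrightarrow> dist x y < e"
proof -
  obtain \<T> where T: "triangulation \<T>" and dia: "\<And>K. K \<in> \<T> \<Longrightarrow> diameter K < e"
    and dim: "\<And>K. K \<in> \<T> \<Longrightarrow> aff_dim K = aff_dim P" and un: "\<Union>\<T> = \<Union>{P}"
  proof (rule fine_triangular_subdivision_of_cell_complex[of e "{P}" "aff_dim P"])
    show "C1 \<inter> C2 face_of C1" if "C1 \<in> {P}" "C2 \<in> {P}" for C1 C2
      using that assms(1) by (simp add: face_of_refl polytope_imp_convex)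
  qed (use assms in auto)
  have fin: "finite \<T>" and face: "\<And>K L. K \<in> \<T> \<Longrightarrow> L \<in> \<T> \<Longrightarrow> (K \<inter> L) face_of K"
    using T by (auto simp: triangulation_def)
  have "\<exists>C. \<not> affine_dependent C \<and> card C = k \<and> K = convex hull C" if K: "K \<in> \<T>" for K
  proof -
    obtain n where n: "n simplex K"
      using T K by (auto simp: triangulation_def)
    then obtain C where "\<not> affine_dependent C" "int (card C) = n + 1" "K = convex hull C"
      unfolding simplex_def by blast
    moreover have "n = int k - 1"
      using aff_dim_simplex[OF n] dim[OF K] assms(2) by simp
    ultimately show ?thesis
      by auto
  qed
  then obtain V where V: "\<And>K. K \<in> \<T> \<Longrightarrow> \<not> affine_dependent (V K) \<and> card (V K) = k \<and> K = convex hull (V K)"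
    by metis
  show thesis
  proof (rule that[of "V ` \<T>"])
    show "simplex_triangulation P k (V ` \<T>)"
    proof
      show "finite (V ` \<T>)"
        using fin by simp
      show "(\<Union>C\<in>V ` \<T>. convex hull C) = P"
        using V un by auto
      show "convex hull C \<inter> convex hull D = convex hull (C \<inter> D)" if CD: "C \<in> V ` \<T>" "D \<in> V ` \<T>" for C D
      proof -
        obtain K L where KL: "K \<in> \<T>" "C = V K" "L \<in> \<T>" "D = V L"
          using CD by auto
        have "K = convex hull C" "L = convex hull D"
          using V KL by auto
        then show ?thesis
          using affine_independent_inter_hulls[of C D] V[of K] V[of L] KL face[of K L] face[of L K]
          by (simp add: Int_commute)
      qed
      qed (use assms V in auto)
    show "dist x y < e" if C: "C \<in> V ` \<T>" "x \<in> C" "y \<in> C" for C x y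
    proof -
      obtain K where K: "K \<in> \<T>" "C = V K"
        using C(1) by auto
      then have "x \<in> K" "y \<in> K"
        using C V[OF K(1)] hull_inc by metis+
      moreover have "bounded K"
        using V[OF K(1)] aff_independent_finite bounded_convex_hull finite_imp_bounded by metis
      ultimately show ?thesis
        using diameter_bounded_bound dia[OF K(1)] by fastforce
    qed
  qed
qed

section \<open>Generic points and separating hyperplanes\<close>

text \<open>The complement in \<open>P\<close> of a closed convex set of smaller dimension is open
  and dense in \<open>P\<close>, so Baire's theorem applies.\<close>

lemma generic_point_near:
  fixes P :: "'a::euclidean_space set"
  assumes "closed P" "convex P" "finite \<A>" "p \<in> P" "0 < e"
    and low: "\<And>S. S \<in> \<A> \<Longrightarrow> closed S \<and> convex S \<and> aff_dim S < aff_dim P"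
  obtains q where "q \<in> P" "dist q p < e" "\<And>S. S \<in> \<A> \<Longrightarrow> q \<notin> S"
proof -
  \<comment> \<open>Inserting \<open>{}\<close> puts \<open>P\<close> itself among the intersected
    sets, which keeps the intersection inside \<open>P\<close> even if \<open>\<A>\<close> is
    empty.\<close>
  have "P \<subseteq> closure (\<Inter> ((\<lambda>S. P - S) ` insert {} \<A>))"
  proof (rule Baire[OF \<open>closed P\<close>])
    show "countable ((\<lambda>S. P - S) ` insert {} \<A>)"
      using \<open>finite \<A>\<close> by (simp add: countable_finite)
    show "openin (top_of_set P) T \<and> P \<subseteq> closure T" if T: "T \<in> (\<lambda>S. P - S) ` insert {} \<A>" for T
    proof (cases "T = P")
      case True
      then show ?thesis
        by (simp add: closure_subset)
    next
      case False
      then obtain S where S: "S \<in> \<A>" "T = P - S"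
        using T by auto
      have "openin (top_of_set P) (P - S)"
        using low[OF S(1)] by (simp add: Diff_eq open_Compl openin_open_Int)
      moreover have "P \<subseteq> closure (P - S)"
        using low[OF S(1)] assms(1,2) by (simp add: dense_complement_convex_closed)
      ultimately show ?thesis
        using S by simp
    qed
  qed
  then obtain q where "q \<in> \<Inter> ((\<lambda>S. P - S) ` insert {} \<A>)" "dist q p < e"
    using closure_approachable[of p] assms(4,5) by blast
  then have "q \<in> P" "dist q p < e" "\<And>S. S \<in> \<A> \<Longrightarrow> q \<notin> S"
    by blast+
  then show thesis
    by (rule that)
qed

text \<open>The normal vector is the component of \<open>v - g\<close>, for a point \<open>g\<close>
  of \<open>G\<close>, orthogonal to the directions of the affine hull of \<open>G\<close>.\<close>

lemma hyperplane_through_affine_hull: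
  fixes v :: "'a::euclidean_space"
  assumes "v \<notin> affine hull G" "G \<noteq> {}"
  obtains a b where "\<And>x. x \<in> G \<Longrightarrow> a \<bullet> x = b" "a \<bullet> v > b"
proof -
  obtain g where g: "g \<in> G"
    using assms by blast
  obtain s z where s: "s \<in> span ((\<lambda>x. - g + x) ` G)" and sz: "v - g = s + z"
    and z: "\<And>w. w \<in> span ((\<lambda>x. - g + x) ` G) \<Longrightarrow> orthogonal z w"
    using orthogonal_subspace_decomp_exists[of "(\<lambda>x. - g + x) ` G" "v - g"] by metis
  have "z \<noteq> 0"
  proof
    assume "z = 0"
    then have "v - g \<in> span ((\<lambda>x. - g + x) ` G)"
      using s sz by simp
    then have "v \<in> affine hull G"
      using affine_hull_span_gen[of g G] g hull_inc[of g G affine]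
      by (metis (no_types, lifting) add_diff_cancel_left' diff_add_cancel image_eqI add.commute)
    then show False
      using assms by simp
  qed
  show thesis
  proof (rule that[of z "z \<bullet> g"])
    fix x assume "x \<in> G"
    then have "orthogonal z (- g + x)"
      by (intro z span_base) auto
    then show "z \<bullet> x = z \<bullet> g"
      by (simp add: orthogonal_def inner_add_right inner_diff_right)
  next
    have "z \<bullet> (v - g) = z \<bullet> z"
      using z[OF s] by (simp add: sz orthogonal_def inner_add_right)
    then show "z \<bullet> v > z \<bullet> g"
      using \<open>z \<noteq> 0\<close> by (simp add: inner_diff_right) (metis inner_gt_zero_iff less_iff_diff_less_0 minus_diff_eq neg_0_less_iff_less)
  qed
qed

section \<open>Ridges of a triangulation and the simplices on their two sides\<close>

context simplex_triangulation
begin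

lemma simplex_subset: "C \<in> \<C> \<Longrightarrow> C \<subseteq> P"
  using simplices_cover hull_subset[of C convex] by blast

lemma affine_hull_simplex:
  assumes "C \<in> \<C>"
  shows "affine hull C = affine hull P"
proof -
  have "aff_dim C = aff_dim P"
    using aff_dim_affine_independent[OF indep_simplex[OF assms]] card_simplex[OF assms] aff_dim_P by simp
  then show ?thesis
    using aff_dim_eq_full_gen simplex_subset[OF assms] by blast
qed

lemma coface_eq_insert:
  assumes "C \<in> \<C>" "G \<subseteq> C" "Suc (card G) = k"
  obtains v where "v \<notin> G" "C = insert v G"
proof -
  have "finite C"
    using aff_independent_finite[OF indep_simplex[OF assms(1)]] .
  then have "card (C - G) = 1"
    using assms card_simplex[OF assms(1)] card_Diff_subset[of G C] finite_subset[of G C] by simp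
  then obtain v where "C - G = {v}"
    by (meson card_1_singletonE)
  then show thesis
    using that[of v] assms(2) by blast
qed

text \<open>Walk from an interior point \<open>q\<close> of the ridge towards \<open>u\<close>.
  Finitely many simplices cover the open segment, so one of them meets the segment in a set having
  \<open>q\<close> in its closure. It contains \<open>q\<close>, hence the whole ridge, and it
  reaches the side of \<open>u\<close>, so its remaining vertex lies on that side.\<close>

lemma simplex_beyond_ridge:
  assumes C0: "C0 \<in> \<C>" "G \<subseteq> C0" and "Suc (card G) = k"
    and q: "q \<in> rel_interior (convex hull G)"
    and ab: "\<And>x. x \<in> G \<Longrightarrow> a \<bullet> x = b" and u: "u \<in> P" "a \<bullet> u > b"
  obtains v where "v \<notin> G" "insert v G \<in> \<C>" "a \<bullet> v > b"
proof -
  have q_hull: "q \<in> convex hull G"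
    using q rel_interior_subset by blast
  have "convex hull G \<subseteq> {x. a \<bullet> x = b}"
    using ab by (intro hull_minimal convex_hyperplane) auto
  then have aq: "a \<bullet> q = b"
    using q_hull by auto
  have qP: "q \<in> P"
    using q_hull C0 simplices_cover hull_mono[of G C0 convex] by blast
  have "q \<noteq> u"
    using aq u by auto
  let ?s = "open_segment q u"
  have seg_P: "?s \<subseteq> P"
    using closed_segment_subset[OF qP u(1)] polytope_imp_convex[OF polytope_P] open_closed_segment by blast
  have seg_side: "a \<bullet> x > b" if x: "x \<in> ?s" for x
  proof -
    obtain t where t: "0 < t" "x = (1 - t) *\<^sub>R q + t *\<^sub>R u"
      using x by (auto simp: in_segment)
    have "a \<bullet> x = b + t * (a \<bullet> u - b)"
      using aq by (simp add: t(2) inner_add_right algebra_simps)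
    then show ?thesis
      using t(1) u(2) by simp
  qed
  have "?s = (\<Union>C\<in>\<C>. ?s \<inter> convex hull C)"
    using seg_P simplices_cover by blast
  also have "\<dots> \<subseteq> (\<Union>C\<in>\<C>. closure (?s \<inter> convex hull C))"
    by (intro UN_mono closure_subset order_refl)
  finally have "?s \<subseteq> (\<Union>C\<in>\<C>. closure (?s \<inter> convex hull C))" .
  then have "closure ?s \<subseteq> (\<Union>C\<in>\<C>. closure (?s \<inter> convex hull C))"
    using finite_simplices by (intro closure_minimal closed_UN) auto
  moreover have "q \<in> closure ?s"
    using \<open>q \<noteq> u\<close> by (simp add: closure_open_segment)
  ultimately obtain C where C: "C \<in> \<C>" "q \<in> closure (?s \<inter> convex hull C)"
    by blast
  have "closed (convex hull C)"
    using aff_independent_finite[OF indep_simplex[OF C(1)]]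
    by (simp add: finite_imp_compact_convex_hull compact_imp_closed)
  then have qC: "q \<in> convex hull C"
    using C(2) closure_minimal[of "?s \<inter> convex hull C" "convex hull C"] by auto
  obtain x where x: "x \<in> ?s" "x \<in> convex hull C"
    using C(2) closure_empty by (metis Int_iff empty_iff equals0I)
  \<comment> \<open>The common face of the two simplices is a face of the hull of \<open>C0\<close>
    and meets the relative interior of the hull of \<open>G\<close>; a face with this property
    contains all of it.\<close>
  have "q \<in> convex hull (C \<inter> C0)"
    using hull_Int[OF C(1) C0(1)] qC q_hull hull_mono[OF C0(2), of convex] by blast
  then have "convex hull (C \<inter> C0) \<inter> rel_interior (convex hull G) \<noteq> {}"
    using q by blast
  moreover have "convex hull (C \<inter> C0) face_of convex hull C0"
    using face_of_convex_hull_affine_independent[OF indep_simplex[OF C0(1)]] by blast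
  ultimately have "convex hull G \<subseteq> convex hull (C \<inter> C0)"
    using subset_of_face_of hull_mono[OF C0(2), of convex] by blast
  then have "G \<subseteq> C \<inter> C0"
    using mem_hull_subset_affine_independent[OF indep_simplex[OF C0(1)], of "C \<inter> C0"] C0(2)
      hull_subset[of G convex] by blast
  then obtain v where v: "v \<notin> G" "C = insert v G"
    using coface_eq_insert[OF C(1) _ assms(3)] by blast
  have "a \<bullet> v > b"
  proof (rule ccontr)
    assume "\<not> a \<bullet> v > b"
    then have "convex hull C \<subseteq> {x. a \<bullet> x \<le> b}"
      using v ab by (intro hull_minimal convex_halfspace_le) auto
    then show False
      using x seg_side by force
  qed
  then show thesis
    using that v C(1) by blast
qed

text \<open>Two different simplices on the same side of \<open>G\<close> would share a point
  strictly on that side, whereas by \<open>hull_Int\<close> they meet only in the hull of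
  \<open>G\<close>, which lies in the hyperplane.\<close>

lemma simplex_beyond_ridge_unique:
  assumes v: "insert v G \<in> \<C>" "v \<notin> G" and w: "insert w G \<in> \<C>" "w \<notin> G"
    and "G \<noteq> {}" and ab: "\<And>x. x \<in> G \<Longrightarrow> a \<bullet> x = b" "a \<bullet> v > b" "a \<bullet> w > b"
  shows "v = w"
proof (rule ccontr)
  assume "v \<noteq> w"
  have fin: "finite G"
    using aff_independent_finite[OF indep_simplex[OF v(1)]] by simp
  have "v \<in> affine hull insert w G"
    using affine_hull_simplex[OF v(1)] affine_hull_simplex[OF w(1)] hull_inc[of v "insert v G" affine] by simp
  then obtain \<beta> where \<beta>: "(\<Sum>x\<in>insert w G. \<beta> x) = 1" "(\<Sum>x\<in>insert w G. \<beta> x *\<^sub>R x) = v"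
    using affine_hull_finite[of "insert w G"] fin by auto
  have \<beta>1: "(\<Sum>x\<in>G. \<beta> x) = 1 - \<beta> w" and \<beta>v: "(\<Sum>x\<in>G. \<beta> x *\<^sub>R x) = v - \<beta> w *\<^sub>R w"
    using \<beta> fin w(2) by (auto simp: algebra_simps)
  have "a \<bullet> (\<Sum>x\<in>G. \<beta> x *\<^sub>R x) = (\<Sum>x\<in>G. \<beta> x * b)"
    unfolding inner_sum_right using ab(1) by (intro sum.cong) auto
  also have "\<dots> = (1 - \<beta> w) * b"
    by (simp add: sum_distrib_right[symmetric] \<beta>1)
  finally have "a \<bullet> v - b = \<beta> w * (a \<bullet> w - b)"
    unfolding \<beta>v by (simp add: inner_diff_right algebra_simps)
  then have \<beta>w: "0 < \<beta> w"
    using ab(2,3) by (metis diff_gt_0_iff_gt zero_less_mult_pos2)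
  define m where "m = real (card G)"
  have m: "m > 0"
    using fin \<open>G \<noteq> {}\<close> by (simp add: m_def card_gt_0_iff)
  define B where "B = (\<Sum>x\<in>G. \<bar>\<beta> x\<bar>)"
  have B: "\<bar>\<beta> x\<bar> \<le> B" if "x \<in> G" for x
    unfolding B_def using member_le_sum[of x G "\<lambda>x. \<bar>\<beta> x\<bar>"] that fin by auto
  have B0: "B \<ge> 0"
    by (simp add: B_def sum_nonneg)
  \<comment> \<open>Moving from the barycentre of \<open>G\<close> towards \<open>v\<close>, one stays inside the simplex on
    \<open>insert w G\<close> for a while.\<close>
  define e where "e = 1 / (1 + m * B)"
  have pos: "1 + m * B > 0"
    using m B0 by (simp add: add_pos_nonneg)
  have e: "0 < e" "e \<le> 1"
    using pos m B0 by (simp_all add: e_def)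
  \<comment> \<open>This identity motivates the choice of \<open>e\<close>: the weight of a vertex
    \<open>x\<close> of \<open>G\<close> in the second representation of the point \<open>z\<close>
    below becomes \<open>e * (B + \<beta> x)\<close>, which is nonnegative.\<close>
  have eB: "(1 - e) / m = e * B"
  proof -
    have "1 - e = m * B / (1 + m * B)"
      using pos by (simp add: e_def diff_divide_eq_iff)
    then show ?thesis
      using m by (simp add: e_def)
  qed
  define z where "z = (\<Sum>x\<in>G. ((1 - e) / m) *\<^sub>R x) + e *\<^sub>R v"
  have "z \<in> convex hull insert v G"
  proof -
    have "z = (\<Sum>x\<in>insert v G. (if x = v then e else (1 - e) / m) *\<^sub>R x)"
      using fin v(2) by (auto simp: z_def intro!: sum.cong)
    also have "\<dots> \<in> convex hull insert v G"
    proof (rule convex_sum)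
      have "(\<Sum>x\<in>G. if x = v then e else (1 - e) / m) = (\<Sum>x\<in>G. (1 - e) / m)"
        using v(2) by (intro sum.cong) auto
      then show "(\<Sum>x\<in>insert v G. if x = v then e else (1 - e) / m) = 1"
        using fin v(2) \<open>G \<noteq> {}\<close> by (simp add: m_def)
    qed (use fin e m in \<open>auto intro: hull_inc\<close>)
    finally show ?thesis .
  qed
  moreover have "z \<in> convex hull insert w G"
  proof -
    have "v = \<beta> w *\<^sub>R w + (\<Sum>x\<in>G. \<beta> x *\<^sub>R x)"
      using \<beta>v by simp
    then have "z = (\<Sum>x\<in>G. ((1 - e) / m) *\<^sub>R x) + (e * \<beta> w) *\<^sub>R w + (\<Sum>x\<in>G. (e * \<beta> x) *\<^sub>R x)"
      by (simp add: z_def scaleR_sum_right algebra_simps)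
    also have "\<dots> = (e * \<beta> w) *\<^sub>R w + (\<Sum>x\<in>G. ((1 - e) / m + e * \<beta> x) *\<^sub>R x)"
      by (simp add: sum.distrib scaleR_add_left)
    also have "\<dots> = (\<Sum>x\<in>insert w G. (if x = w then e * \<beta> w else (1 - e) / m + e * \<beta> x) *\<^sub>R x)"
      using fin w(2) by (auto intro!: sum.cong)
    also have "\<dots> \<in> convex hull insert w G"
    proof (rule convex_sum)
      have "(\<Sum>x\<in>G. if x = w then e * \<beta> w else (1 - e) / m + e * \<beta> x) = (\<Sum>x\<in>G. (1 - e) / m + e * \<beta> x)"
        using w(2) by (intro sum.cong) auto
      also have "\<dots> = (1 - e) + e * (1 - \<beta> w)"
        using m by (simp add: sum.distrib m_def \<beta>1 sum_distrib_left[symmetric])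
      finally show "(\<Sum>x\<in>insert w G. if x = w then e * \<beta> w else (1 - e) / m + e * \<beta> x) = 1"
        using fin w(2) by (simp add: algebra_simps)
      show "0 \<le> (if x = w then e * \<beta> w else (1 - e) / m + e * \<beta> x)" if "x \<in> insert w G" for x
      proof (cases "x = w")
        case True
        then show ?thesis using e \<beta>w by simp
      next
        case False
        then have "\<bar>\<beta> x\<bar> \<le> B"
          using that B by simp
        then have "0 \<le> B + \<beta> x"
          by simp
        then have "0 \<le> e * (B + \<beta> x)"
          using e by simp
        then show ?thesis
          using False eB by (simp add: algebra_simps)
      qed
    qed (use fin in \<open>auto intro: hull_inc\<close>)
    finally show ?thesis .
  qed
  ultimately have "z \<in> convex hull (insert v G \<inter> insert w G)"
    using hull_Int[OF v(1) w(1)] by blast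
  moreover have "insert v G \<inter> insert w G = G"
    using v(2) w(2) \<open>v \<noteq> w\<close> by auto
  moreover have "convex hull G \<subseteq> {x. a \<bullet> x = b}"
    using ab by (intro hull_minimal convex_hyperplane) auto
  ultimately have "a \<bullet> z = b"
    by auto
  moreover have "a \<bullet> z = b + e * (a \<bullet> v - b)"
  proof -
    have "a \<bullet> (\<Sum>x\<in>G. ((1 - e) / m) *\<^sub>R x) = (\<Sum>x\<in>G. (1 - e) / m * b)"
      unfolding inner_sum_right using ab(1) by (intro sum.cong) auto
    also have "\<dots> = (1 - e) * b"
      using m by (simp add: m_def)
    finally show ?thesis
      by (simp add: z_def inner_add_right algebra_simps)
  qed
  ultimately show False
    using e(1) ab(2) by simp
qed

text \<open>If such a ridge has a coface, it has exactly two, one on each side of a hyperplane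
  through it. As no proper face of \<open>P\<close> contains the ridge, a relative interior point
  \<open>q\<close> of its hull is relatively interior to \<open>P\<close>. The segment from
  \<open>v0\<close> to \<open>q\<close> can therefore be prolonged inside \<open>P\<close> to a
  point \<open>u\<close> on the other side, where a second simplex is found.\<close>

lemma even_card_cofaces:
  assumes "G \<noteq> {}" and card_G: "Suc (card G) = k"
    and interior: "\<And>\<tau>. \<tau> face_of P \<Longrightarrow> G \<subseteq> \<tau> \<Longrightarrow> \<tau> = P"
  shows "even (card {C \<in> \<C>. G \<subseteq> C})"
proof (cases "{C \<in> \<C>. G \<subseteq> C} = {}")
  case False
  then obtain C0 where C0: "C0 \<in> \<C>" "G \<subseteq> C0"
    by blast
  obtain v0 where v0: "v0 \<notin> G" "C0 = insert v0 G"
    using coface_eq_insert[OF C0 card_G] .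
  have "v0 \<notin> affine hull G"
    using indep_simplex[OF C0(1)] v0 unfolding affine_dependent_def by (metis Diff_insert_absorb insertI1)
  then obtain a b where ab: "\<And>x. x \<in> G \<Longrightarrow> a \<bullet> x = b" "a \<bullet> v0 > b"
    using hyperplane_through_affine_hull assms(1) by blast
  obtain q where q: "q \<in> rel_interior (convex hull G)"
    using rel_interior_eq_empty[of "convex hull G"] assms(1) by auto
  have hull_G: "convex hull G \<subseteq> P"
    using C0 simplices_cover hull_mono[of G C0 convex] by blast
  have "q \<in> rel_interior P"
  proof (rule ccontr)
    assume "q \<notin> rel_interior P"
    moreover have "q \<in> P"
      using q hull_G rel_interior_subset by blast
    ultimately have "q \<in> rel_frontier P"
      by (simp add: rel_frontier_def polytope_imp_closed[OF polytope_P] closure_closed)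
    then obtain F where F: "F face_of P" "F \<noteq> P" "q \<in> F"
      using rel_frontier_of_polyhedron_alt[OF polytope_imp_polyhedron[OF polytope_P]] by auto
    then have "convex hull G \<subseteq> F"
      using subset_of_face_of[OF F(1) hull_G] q by blast
    then show False
      using interior[OF F(1)] F(2) hull_subset[of G convex] by blast
  qed
  moreover have "v0 \<in> P"
    using simplex_subset C0 v0 by blast
  ultimately obtain t where t: "t > 1" "(1 - t) *\<^sub>R v0 + t *\<^sub>R q \<in> P"
    using convex_rel_interior_iff[of P q] polytope_imp_convex[OF polytope_P] by blast
  define u where "u = (1 - t) *\<^sub>R v0 + t *\<^sub>R q"
  have "convex hull G \<subseteq> {x. a \<bullet> x = b}"
    using ab by (intro hull_minimal convex_hyperplane) auto
  then have "a \<bullet> q = b"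
    using q rel_interior_subset by blast
  then have "a \<bullet> u = b + (1 - t) * (a \<bullet> v0 - b)"
    by (simp add: u_def inner_add_right algebra_simps)
  moreover have "(1 - t) * (a \<bullet> v0 - b) < 0"
    using t ab(2) by (simp add: mult_neg_pos)
  ultimately have u: "u \<in> P" "- a \<bullet> u > - b"
    using t by (auto simp: u_def)
  obtain v1 where v1: "v1 \<notin> G" "insert v1 G \<in> \<C>" "- a \<bullet> v1 > - b"
    using simplex_beyond_ridge[OF C0 card_G q _ u] ab(1) by auto
  have "{C \<in> \<C>. G \<subseteq> C} = {insert v0 G, insert v1 G}"
  proof
    show "{insert v0 G, insert v1 G} \<subseteq> {C \<in> \<C>. G \<subseteq> C}"
      using C0 v0 v1 by auto
    show "{C \<in> \<C>. G \<subseteq> C} \<subseteq> {insert v0 G, insert v1 G}"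
    proof
      fix C assume "C \<in> {C \<in> \<C>. G \<subseteq> C}"
      then have C: "C \<in> \<C>" "G \<subseteq> C"
        by auto
      obtain v where v: "v \<notin> G" "C = insert v G"
        using coface_eq_insert[OF C card_G] .
      \<comment> \<open>Otherwise the hyperplane would contain the affine hull of \<open>C\<close>,
        which is that of \<open>P\<close>, and hence the point \<open>v0\<close>.\<close>
      have "a \<bullet> v \<noteq> b"
      proof
        assume "a \<bullet> v = b"
        then have "affine hull C \<subseteq> {x. a \<bullet> x = b}"
          using v ab(1) by (intro hull_minimal affine_hyperplane) auto
        then show False
          using affine_hull_simplex[OF C(1)] hull_inc[OF \<open>v0 \<in> P\<close>, of affine] ab(2) by auto
      qed
      then consider "a \<bullet> v > b" | "- a \<bullet> v > - b"
        by fastforce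
      then show "C \<in> {insert v0 G, insert v1 G}"
      proof cases
        case 1
        then have "v = v0"
          using simplex_beyond_ridge_unique[of v G v0 a b] C C0 v v0 assms(1) ab by auto
        then show ?thesis using v by simp
      next
        case 2
        then have "v = v1"
          using simplex_beyond_ridge_unique[of v G v1 "- a" "- b"] C v v1 assms(1) ab by auto
        then show ?thesis using v by simp
      qed
    qed
  qed
  moreover have "v0 \<noteq> v1"
    using v1(3) ab(2) by auto
  then have "insert v0 G \<noteq> insert v1 G"
    using v0(1) v1(1) by auto
  ultimately show ?thesis
    by simp
next
  case True
  then show ?thesis
    by (metis card.empty even_zero)
qed

end

subsection \<open>Hulls covering a generic point\<close>

lemma convex_hull_image_finite:
  fixes \<pi> :: "'v \<Rightarrow> 'a::real_vector"
  assumes "finite B" "inj_on \<pi> B" "p \<in> convex hull (\<pi> ` B)"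
  obtains \<nu> where "\<And>d. d \<in> B \<Longrightarrow> 0 \<le> \<nu> d" "(\<Sum>d\<in>B. \<nu> d) = 1" "(\<Sum>d\<in>B. \<nu> d *\<^sub>R \<pi> d) = p"
proof -
  obtain u where u: "\<forall>x\<in>\<pi> ` B. 0 \<le> u x" "sum u (\<pi> ` B) = 1" "(\<Sum>x\<in>\<pi> ` B. u x *\<^sub>R x) = p"
    using assms(3) convex_hull_finite[of "\<pi> ` B"] assms(1) by auto
  show thesis
  proof (rule that[of "u \<circ> \<pi>"])
    show "(\<Sum>d\<in>B. (u \<circ> \<pi>) d) = 1" "(\<Sum>d\<in>B. (u \<circ> \<pi>) d *\<^sub>R \<pi> d) = p"
      using u sum.reindex[OF assms(2), of u] sum.reindex[OF assms(2), of "\<lambda>x. u x *\<^sub>R x"] by simp_all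
  qed (use u in auto)
qed

lemma weighted_sum_in_convex_hull_image:
  fixes \<pi> :: "'v \<Rightarrow> 'a::real_vector"
  assumes "finite D" "B \<subseteq> D" "\<And>d. d \<in> D \<Longrightarrow> 0 \<le> \<nu> d" "(\<Sum>d\<in>D. \<nu> d) = 1"
    and "\<And>d. d \<in> D - B \<Longrightarrow> \<nu> d = 0"
  shows "(\<Sum>d\<in>D. \<nu> d *\<^sub>R \<pi> d) \<in> convex hull (\<pi> ` B)"
proof -
  have eq: "sum \<nu> B = sum \<nu> D" "(\<Sum>d\<in>B. \<nu> d *\<^sub>R \<pi> d) = (\<Sum>d\<in>D. \<nu> d *\<^sub>R \<pi> d)"
    using assms(1,2,5) by (intro sum.mono_neutral_left; simp)+
  have "(\<Sum>d\<in>B. \<nu> d *\<^sub>R \<pi> d) \<in> convex hull (\<pi> ` B)"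
    using assms eq finite_subset by (intro convex_sum) (auto intro: hull_inc)
  then show ?thesis
    using eq by simp
qed

text \<open>The weights on \<open>D\<close> representing a generic point form a segment, and each of its two end
  points has exactly one vanishing weight.\<close>

lemma even_card_facets_covering_generic_point:
  fixes \<pi> :: "'v \<Rightarrow> 'a::euclidean_space"
  assumes "finite D" "card D = Suc k" and D_L: "\<pi> ` D \<subseteq> affine hull L" and dim: "aff_dim L = int k - 1"
    and generic: "\<And>G. G \<subseteq> D \<Longrightarrow> card G < k \<Longrightarrow> p \<notin> convex hull (\<pi> ` G)"
  shows "even (card {x \<in> D. p \<in> convex hull (\<pi> ` (D - {x}))})"
proof -
  define X where "X = {x \<in> D. p \<in> convex hull (\<pi> ` (D - {x}))}"
  \<comment> \<open>By Caratheodory's theorem \<open>p\<close> is in the hull of at most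
    \<open>aff_dim + 1\<close> of these points, and genericity forces at least \<open>k\<close> of
    them. So the \<open>k\<close> points are distinct and affinely independent.\<close>
  have indep: "inj_on \<pi> (D - {x}) \<and> \<not> affine_dependent (\<pi> ` (D - {x}))" if "x \<in> X" for x
  proof -
    let ?E = "D - {x}"
    have E: "finite ?E" "card ?E = k"
      using assms(1,2) that by (auto simp: X_def)
    have "p \<in> convex hull (\<pi> ` ?E)"
      using that by (simp add: X_def)
    then obtain S where S: "S \<subseteq> \<pi> ` ?E" "int (card S) \<le> aff_dim (\<pi> ` ?E) + 1" "p \<in> convex hull S"
      using caratheodory_aff_dim[of "\<pi> ` ?E"] by auto
    obtain G where G: "G \<subseteq> ?E" "inj_on \<pi> G" "S = \<pi> ` G"
      using S(1) subset_image_inj[of S \<pi> ?E] by blast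
    have "card G \<ge> k"
      using generic[of G] G S(3) by (meson Diff_subset linorder_not_less order_trans)
    then have "G = ?E"
      using G(1) E card_subset_eq[of ?E G] card_mono[of ?E G] by auto
    then have "inj_on \<pi> ?E" "aff_dim (\<pi> ` ?E) \<ge> int k - 1"
      using G S(2) E card_image[OF G(2)] by auto
    moreover have "card (\<pi> ` ?E) = k"
      using card_image[OF calculation(1)] E by simp
    ultimately show ?thesis
      using aff_dim_le_card[of "\<pi> ` ?E"] E affine_independent_iff_card[of "\<pi> ` ?E"] by auto
  qed
  have partner: "\<exists>m\<in>X. m \<noteq> x \<and> (\<forall>y\<in>X. y \<noteq> x \<longrightarrow> y = m)" if x: "x \<in> X" for x
  proof -
    define E where "E = D - {x}"
    have xD: "x \<in> D" and p_E: "p \<in> convex hull (\<pi> ` E)"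
      using x by (auto simp: X_def E_def)
    have D_eq: "D = insert x E" "x \<notin> E" "finite E" "card E = k"
      using xD assms(1,2) by (auto simp: E_def)
    have inj: "inj_on \<pi> E" and ind: "\<not> affine_dependent (\<pi> ` E)"
      using indep[OF x] by (auto simp: E_def)
    have unique: "\<alpha> d = \<beta> d" if "(\<Sum>d\<in>E. \<alpha> d) = (\<Sum>d\<in>E. \<beta> d)"
        "(\<Sum>d\<in>E. \<alpha> d *\<^sub>R \<pi> d) = (\<Sum>d\<in>E. \<beta> d *\<^sub>R \<pi> d)" "d \<in> E" for \<alpha> \<beta> d
    proof (rule ccontr)
      assume neq: "\<alpha> d \<noteq> \<beta> d"
      define U where "U y = \<alpha> (the_inv_into E \<pi> y) - \<beta> (the_inv_into E \<pi> y)" for y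
      have U: "U (\<pi> e) = \<alpha> e - \<beta> e" if "e \<in> E" for e
        using that by (simp add: U_def the_inv_into_f_f[OF inj])
      have "sum U (\<pi> ` E) = 0" "(\<Sum>v\<in>\<pi> ` E. U v *\<^sub>R v) = 0"
        using that(1,2) U
        by (simp_all add: sum.reindex[OF inj] sum_subtractf scaleR_diff_left cong: sum.cong)
      moreover have "U (\<pi> d) \<noteq> 0"
        using U neq that(3) by simp
      ultimately show False
        using ind affine_dependent_explicit_finite[of "\<pi> ` E"] D_eq that(3) by blast
    qed
    obtain \<kappa> where \<kappa>: "\<And>d. d \<in> E \<Longrightarrow> 0 \<le> \<kappa> d" "(\<Sum>d\<in>E. \<kappa> d) = 1" "(\<Sum>d\<in>E. \<kappa> d *\<^sub>R \<pi> d) = p"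
      using convex_hull_image_finite[OF D_eq(3) inj p_E] by blast
    \<comment> \<open>A vanishing weight would put \<open>p\<close> into the hull of fewer than
      \<open>k\<close> points.\<close>
    have \<kappa>_pos: "0 < \<kappa> d" if d: "d \<in> E" for d
    proof (rule ccontr)
      assume "\<not> 0 < \<kappa> d"
      then have "\<kappa> d = 0"
        using \<kappa>(1)[OF d] by simp
      then have "p \<in> convex hull (\<pi> ` (E - {d}))"
        using weighted_sum_in_convex_hull_image[of E "E - {d}" \<kappa> \<pi>] \<kappa> D_eq by auto
      moreover have "card (E - {d}) < k"
        using D_eq d card_Diff1_less[of E d] by simp
      ultimately show False
        using generic[of "E - {d}"] by (auto simp: E_def)
    qed
    have "affine hull (\<pi> ` E) = affine hull (affine hull L)"
    proof (rule iffD1[OF aff_dim_eq_full_gen])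
      show "\<pi> ` E \<subseteq> affine hull L"
        using D_L D_eq by auto
      show "aff_dim (\<pi> ` E) = aff_dim (affine hull L)"
        using ind affine_independent_iff_card[of "\<pi> ` E"] card_image[OF inj] D_eq dim by simp
    qed
    then have "\<pi> x \<in> affine hull (\<pi> ` E)"
      using D_L xD by auto
    then obtain u where u: "sum u (\<pi> ` E) = 1" "(\<Sum>v\<in>\<pi> ` E. u v *\<^sub>R v) = \<pi> x"
      using affine_hull_finite[of "\<pi> ` E"] D_eq by auto
    define \<mu> where "\<mu> = u \<circ> \<pi>"
    have \<mu>: "(\<Sum>d\<in>E. \<mu> d) = 1" "(\<Sum>d\<in>E. \<mu> d *\<^sub>R \<pi> d) = \<pi> x"
      using u by (simp_all add: \<mu>_def sum.reindex[OF inj])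
    define J where "J = {d \<in> E. \<mu> d > 0}"
    have "J \<noteq> {}"
    proof
      assume "J = {}"
      then have "(\<Sum>d\<in>E. \<mu> d) \<le> 0"
        by (intro sum_nonpos) (auto simp: J_def not_less)
      then show False
        using \<mu>(1) by simp
    qed
    moreover have "finite J"
      using D_eq by (simp add: J_def)
    ultimately obtain m where m: "m \<in> J" and m_min: "\<And>d. d \<in> J \<Longrightarrow> \<kappa> m / \<mu> m \<le> \<kappa> d / \<mu> d"
      using arg_min_if_finite[of J "\<lambda>d. \<kappa> d / \<mu> d"] by (metis linorder_not_less)
    \<comment> \<open>With \<open>\<mu>\<close> the affine coordinates of \<open>\<pi> x\<close>
      over \<open>E\<close>, shifting weight \<open>s\<close> onto \<open>x\<close> leaves the
      weights \<open>\<kappa> d - s * \<mu> d\<close> on \<open>E\<close>. The minimal ratio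
      \<open>t\<close> is the largest \<open>s\<close> keeping them nonnegative, and
      \<open>m\<close> is a label whose weight vanishes there.\<close>
    define t where "t = \<kappa> m / \<mu> m"
    have mE: "m \<in> E" "\<mu> m > 0"
      using m by (auto simp: J_def)
    have t: "t > 0" "\<kappa> m = t * \<mu> m"
      using mE \<kappa>_pos by (auto simp: t_def)
    have t_le: "t * \<mu> d \<le> \<kappa> d" if "d \<in> E" for d
    proof (cases "\<mu> d > 0")
      case True
      then show ?thesis
        using m_min[of d] that by (simp add: J_def t_def[symmetric] pos_le_divide_eq)
    next
      case False
      then have "t * \<mu> d \<le> 0"
        using t by (simp add: mult_nonneg_nonpos)
      then show ?thesis
        using \<kappa>(1)[OF that] by simp
    qed
    have "m \<in> X"
    proof -
      define \<nu> where "\<nu> d = (if d = x then t else \<kappa> d - t * \<mu> d)" for d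
      have \<nu>E: "\<nu> d = \<kappa> d - t * \<mu> d" if "d \<in> E" for d
        using that D_eq by (auto simp: \<nu>_def)
      have "(\<Sum>d\<in>E. \<nu> d) = 1 - t"
        using \<nu>E \<kappa>(2) \<mu>(1) by (simp add: sum_subtractf sum_distrib_left[symmetric] cong: sum.cong)
      moreover have "(\<Sum>d\<in>E. \<nu> d *\<^sub>R \<pi> d) = (\<Sum>d\<in>E. \<kappa> d *\<^sub>R \<pi> d) - t *\<^sub>R (\<Sum>d\<in>E. \<mu> d *\<^sub>R \<pi> d)"
        using \<nu>E by (simp add: scaleR_diff_left sum_subtractf scaleR_sum_right cong: sum.cong)
      ultimately have "(\<Sum>d\<in>D. \<nu> d) = 1" "(\<Sum>d\<in>D. \<nu> d *\<^sub>R \<pi> d) = p"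
        using D_eq \<kappa>(3) \<mu>(2) by (auto simp: \<nu>_def)
      moreover have "0 \<le> \<nu> d" if "d \<in> D" for d
        using t t_le[of d] that D_eq by (auto simp: \<nu>_def)
      moreover have "\<nu> m = 0"
        using \<nu>E[OF mE(1)] t by simp
      ultimately have "p \<in> convex hull (\<pi> ` (D - {m}))"
        using weighted_sum_in_convex_hull_image[of D "D - {m}" \<nu> \<pi>] assms(1) by auto
      then show ?thesis
        using mE D_eq by (auto simp: X_def)
    qed
    moreover have "m \<noteq> x"
      using mE D_eq by auto
    \<comment> \<open>Weights omitting \<open>y\<close> also have the form
      \<open>\<kappa> d - s * \<mu> d\<close> on \<open>E\<close>, with \<open>s\<close> the weight
      of \<open>x\<close>. Vanishing at \<open>y\<close> and nonnegativity at \<open>m\<close> force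
      \<open>s = t\<close>, so for \<open>y \<noteq> m\<close> two weights vanish, against
      genericity.\<close>
    moreover have "y = m" if y: "y \<in> X" "y \<noteq> x" for y
    proof (rule ccontr)
      assume "y \<noteq> m"
      have yE: "y \<in> E" and p_y: "p \<in> convex hull (\<pi> ` (D - {y}))"
        using y D_eq by (auto simp: X_def)
      have fin_y: "finite (D - {y})" and inj_y: "inj_on \<pi> (D - {y})"
        using assms(1) indep[OF y(1)] by auto
      obtain \<nu>' where \<nu>': "\<And>d. d \<in> D - {y} \<Longrightarrow> 0 \<le> \<nu>' d" "(\<Sum>d\<in>D - {y}. \<nu>' d) = 1"
          "(\<Sum>d\<in>D - {y}. \<nu>' d *\<^sub>R \<pi> d) = p"
        using convex_hull_image_finite[OF fin_y inj_y p_y] by blast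
      define \<nu> where "\<nu> = \<nu>'(y := 0)"
      have \<nu>: "\<And>d. d \<in> D \<Longrightarrow> 0 \<le> \<nu> d" "\<nu> y = 0" "\<And>d. d \<in> D - {y} \<Longrightarrow> \<nu> d = \<nu>' d"
        using \<nu>'(1) by (auto simp: \<nu>_def)
      have "y \<in> D"
        using yE D_eq by auto
      moreover have "(\<Sum>d\<in>D - {y}. \<nu> d) = 1" "(\<Sum>d\<in>D - {y}. \<nu> d *\<^sub>R \<pi> d) = p"
        unfolding \<nu>'(2,3)[symmetric] using \<nu>(3) by (auto intro: sum.cong)
      ultimately have \<nu>_sum: "(\<Sum>d\<in>D. \<nu> d) = 1" "(\<Sum>d\<in>D. \<nu> d *\<^sub>R \<pi> d) = p"
        using \<nu>(2) assms(1) by (simp_all add: sum.remove[of D y])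
      define s where "s = \<nu> x"
      have \<nu>_eq: "\<nu> d = \<kappa> d - s * \<mu> d" if "d \<in> E" for d
      proof (rule unique[OF _ _ that])
        show "(\<Sum>d\<in>E. \<nu> d) = (\<Sum>d\<in>E. \<kappa> d - s * \<mu> d)"
          using \<nu>_sum(1) D_eq \<kappa>(2) \<mu>(1) by (simp add: s_def sum_subtractf sum_distrib_left[symmetric])
        have "(\<Sum>d\<in>E. (\<kappa> d - s * \<mu> d) *\<^sub>R \<pi> d) = (\<Sum>d\<in>E. \<kappa> d *\<^sub>R \<pi> d) - s *\<^sub>R (\<Sum>d\<in>E. \<mu> d *\<^sub>R \<pi> d)"
          by (simp add: scaleR_diff_left sum_subtractf scaleR_sum_right)
        also have "\<dots> = p - s *\<^sub>R \<pi> x"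
          by (simp only: \<kappa>(3) \<mu>(2))
        also have "\<dots> = (\<Sum>d\<in>E. \<nu> d *\<^sub>R \<pi> d)"
          using \<nu>_sum(2) D_eq by (auto simp: s_def)
        finally show "(\<Sum>d\<in>E. \<nu> d *\<^sub>R \<pi> d) = (\<Sum>d\<in>E. (\<kappa> d - s * \<mu> d) *\<^sub>R \<pi> d)"
          by (rule sym)
      qed
      have sy: "\<kappa> y = s * \<mu> y"
        using \<nu>_eq[OF yE] \<nu>(2) by simp
      have "s \<ge> 0"
        using \<nu>(1)[OF xD] by (simp add: s_def)
      then have "s > 0" "\<mu> y > 0"
        using sy \<kappa>_pos[OF yE] by (auto simp: zero_less_mult_iff)
      then have "t \<le> s"
        using t_le[OF yE] sy by simp
      moreover have "s * \<mu> m \<le> t * \<mu> m"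
        using \<nu>_eq[OF mE(1)] \<nu>(1)[of m] mE D_eq t by auto
      then have "s \<le> t"
        using mE by simp
      ultimately have "\<nu> m = 0"
        using \<nu>_eq[OF mE(1)] t by simp
      then have "p \<in> convex hull (\<pi> ` (D - {y, m}))"
        using weighted_sum_in_convex_hull_image[of D "D - {y, m}" \<nu> \<pi>] assms(1) \<nu> \<nu>_sum by auto
      moreover have "card (D - {y, m}) < k"
      proof -
        have "card (D - {y, m}) = card D - card {y, m}"
          using \<open>y \<in> D\<close> mE D_eq by (intro card_Diff_subset) auto
        then show ?thesis
          using assms(2) \<open>y \<noteq> m\<close> D_eq(3,4) mE(1) card_gt_0_iff[of E] by auto
      qed
      ultimately show False
        using generic[of "D - {y, m}"] by auto
    qed
    ultimately show ?thesis
      by blast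
  qed
  have "even (card X)"
  proof (cases "X = {}")
    case False
    then obtain x where x: "x \<in> X"
      by blast
    then obtain m where m: "m \<in> X" "m \<noteq> x" "\<And>y. y \<in> X \<Longrightarrow> y \<noteq> x \<Longrightarrow> y = m"
      using partner[OF x] by blast
    have "y \<in> {x, m}" if "y \<in> X" for y
      using m(3)[OF that] by blast
    then have "X = {x, m}"
      using x m(1) by blast
    then show ?thesis
      using m(2) by simp
  qed simp
  then show ?thesis
    by (simp add: X_def)
qed

subsection \<open>The parity argument\<close>

lemma (in matroid) matroid_restriction:
  assumes "T \<subseteq> W"
  shows "matroid T (\<lambda>X. X \<subseteq> T \<and> indep X)"
proof
  show "\<exists>y\<in>Y - X. insert y X \<subseteq> T \<and> indep (insert y X)"
    if "X \<subseteq> T \<and> indep X" "Y \<subseteq> T \<and> indep Y" "card X < card Y" for X Y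
    using augmentation[of X Y] that by auto
qed (use assms finite_subset[OF assms finite_ground] indep_empty indep_subset in auto)

lemma even_of_nat_bit: "even n \<Longrightarrow> of_nat n = (0::bit)"
  by (auto elim: evenE)

text \<open>Double counting of the incidences \<open>X = D - {x}\<close> between members
  \<open>X\<close> of \<open>\<P>\<close> and their cofaces \<open>D\<close>.\<close>

lemma sum_chain_boundary:
  assumes "finite V" "\<P> \<subseteq> Pow V"
  shows "(\<Sum>X\<in>\<P>. chain_boundary V c X) =
    (\<Sum>D\<in>Pow V. \<Sum>x\<in>D. if D - {x} \<in> \<P> then c D else 0)"
proof -
  have fin: "finite \<P>" "\<And>D. D \<subseteq> V \<Longrightarrow> finite D"
    using assms finite_subset[of \<P> "Pow V"] finite_subset[of _ V] by auto
  have "(\<Sum>X\<in>\<P>. chain_boundary V c X) = (\<Sum>(X, x)\<in>(SIGMA X:\<P>. V - X). c (insert x X))"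
    unfolding chain_boundary_def using fin assms(1) by (intro sum.Sigma) auto
  also have "\<dots> = (\<Sum>(D, x)\<in>(SIGMA D:Pow V. {x \<in> D. D - {x} \<in> \<P>}). c D)"
    by (rule sum.reindex_bij_witness[of _ "\<lambda>(D, x). (D - {x}, x)" "\<lambda>(X, x). (insert x X, x)"])
      (use assms in \<open>auto simp: insert_absorb\<close>)
  also have "\<dots> = (\<Sum>D\<in>Pow V. \<Sum>x\<in>{x \<in> D. D - {x} \<in> \<P>}. c D)"
    using fin assms(1) by (intro sum.Sigma[symmetric]) auto
  also have "\<dots> = (\<Sum>D\<in>Pow V. \<Sum>x\<in>D. if D - {x} \<in> \<P> then c D else 0)"
    using fin by (intro sum.cong sum.inter_filter) auto
  finally show ?thesis .
qed

lemma chain_boundary_simplex: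
  assumes "finite V" "inj_on \<iota> F" "finite F" "\<iota> ` F \<subseteq> V"
  shows "chain_boundary V (\<lambda>X. of_bool (X = \<iota> ` F)) G = (\<Sum>v\<in>F. of_bool (G = \<iota> ` (F - {v})))"
proof -
  have "(\<Sum>v\<in>F. of_bool (G = \<iota> ` (F - {v})) :: bit) = (\<Sum>v\<in>F. of_bool (G = \<iota> ` F - {\<iota> v}))"
  proof (rule sum.cong[OF refl])
    fix v assume "v \<in> F"
    then have "\<iota> ` (F - {v}) = \<iota> ` F - {\<iota> v}"
      using assms(2) by (auto simp: inj_on_def)
    then show "(of_bool (G = \<iota> ` (F - {v})) :: bit) = of_bool (G = \<iota> ` F - {\<iota> v})"
      by simp
  qed
  also have "\<dots> = (\<Sum>x\<in>\<iota> ` F. of_bool (G = \<iota> ` F - {x}))"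
    using assms(2) by (simp add: sum.reindex)
  also have "\<dots> = (\<Sum>x\<in>V - G. of_bool (insert x G = \<iota> ` F))"
  proof (rule sum.mono_neutral_cong)
    show "of_bool (G = \<iota> ` F - {x}) = (of_bool (insert x G = \<iota> ` F) :: bit)" if "x \<in> \<iota> ` F \<inter> (V - G)" for x
      using that by (intro arg_cong[where f = of_bool]) auto
    show "of_bool (insert i G = \<iota> ` F) = (0::bit)" if "i \<in> V - G - \<iota> ` F" for i
      using that by auto
    show "of_bool (G = \<iota> ` F - {i}) = (0::bit)" if "i \<in> \<iota> ` F - (V - G)" for i
      using that assms(4) by auto
  qed (use assms in auto)
  finally show ?thesis
    by (simp add: chain_boundary_def)
qed

context simplex_triangulation
begin

text \<open>A Sperner-type statement with matroid labels: \<open>S F\<close> holds the labels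
  available on the simplex \<open>F\<close>, and \<open>\<pi>\<close> realizes labels as points.
  \<open>S_rank\<close> makes the independence complexes an acyclic carrier, and
  \<open>S_face\<close> makes a chain map carried by them respect the faces of \<open>P\<close>. The
  map \<open>\<iota>\<close> gives the vertices of the triangulation names of the same type, so that
  this chain map can be compared with the identity.\<close>

lemma independent_set_covering_generic_point:
  fixes \<pi> :: "'v \<Rightarrow> 'a" and S :: "'a set \<Rightarrow> 'v set"
  assumes matroid: "matroid E ind" and \<pi>E: "\<pi> ` E \<subseteq> P"
    and \<iota>: "\<And>x. x \<in> \<Union>\<C> \<Longrightarrow> \<pi> (\<iota> x) = x"
    and S_sub: "\<And>F. S F \<subseteq> E"
    and S_mono: "\<And>F G. G \<subseteq> F \<Longrightarrow> S G \<subseteq> S F"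
    and S_rank: "\<And>C F. C \<in> \<C> \<Longrightarrow> F \<subseteq> C \<Longrightarrow> F \<noteq> {} \<Longrightarrow> \<exists>B\<subseteq>S F. ind B \<and> card B = k"
    and S_face: "\<And>F e \<tau>. e \<in> S F \<Longrightarrow> \<tau> face_of P \<Longrightarrow> F \<subseteq> \<tau> \<Longrightarrow> \<pi> e \<in> \<tau>"
    and q: "q \<in> P" "\<And>\<tau>. \<tau> face_of P \<Longrightarrow> \<tau> \<noteq> P \<Longrightarrow> q \<notin> \<tau>"
    and generic: "\<And>G. G \<subseteq> E \<union> \<iota> ` \<Union>\<C> \<Longrightarrow> card G < k \<Longrightarrow> q \<notin> convex hull (\<pi> ` G)"
  shows "\<exists>C\<in>\<C>. \<exists>I\<subseteq>S C. ind I \<and> card I = k \<and> q \<in> convex hull (\<pi> ` I)"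
proof -
  interpret M: matroid E ind by (rule matroid)
  define V where "V = E \<union> \<iota> ` \<Union>\<C>"
  have fin_simplex: "finite C" if "C \<in> \<C>" for C
    using aff_independent_finite[OF indep_simplex[OF that]] .
  have finV: "finite V"
    unfolding V_def using M.finite_ground finite_simplices fin_simplex by auto
  have \<pi>V: "\<pi> ` V \<subseteq> P"
    using \<pi>E \<iota> simplex_subset by (force simp: V_def)
  have \<pi>\<iota>: "\<pi> ` \<iota> ` F = F" if "F \<subseteq> \<Union>\<C>" for F
    using \<iota> that by force
  have inj_\<iota>: "inj_on \<iota> F" if "F \<subseteq> \<Union>\<C>" for F
    using \<iota> that by (metis inj_onI subsetD)
  define \<K> where "\<K> = {F. \<exists>C\<in>\<C>. F \<subseteq> C}"
  have K_fin: "finite F" if "F \<in> \<K>" for F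
    using that fin_simplex finite_subset by (auto simp: \<K>_def)
  have K_closed: "F - {v} \<in> \<K>" if "F \<in> \<K>" for F v
    using that by (auto simp: \<K>_def)
  have K_sub: "F \<subseteq> \<Union>\<C>" if "F \<in> \<K>" for F
    using that by (auto simp: \<K>_def)
  have K_V: "\<iota> ` F \<subseteq> V" if "F \<in> \<K>" for F
    using K_sub[OF that] by (auto simp: V_def)

  obtain \<phi> where \<phi>_empty: "\<And>X. \<phi> {} X = of_bool (X = {})"
    and \<phi>_supp: "\<And>F X. F \<in> \<K> \<Longrightarrow> \<phi> F X \<noteq> 0 \<Longrightarrow> (X \<subseteq> S F \<and> ind X) \<and> card X = card F"
    and \<phi>_bd: "\<And>F G. F \<in> \<K> \<Longrightarrow> chain_boundary V (\<phi> F) G = (\<Sum>v\<in>F. \<phi> (F - {v}) G)"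
  proof (rule acyclic_carrier_chain_map[of V \<K> "\<lambda>F X. X \<subseteq> S F \<and> ind X"])
    fix F d and z :: "'v set \<Rightarrow> bit"
    assume F: "F \<in> \<K>" "card F = Suc d" and z: "\<And>X. z X \<noteq> 0 \<Longrightarrow> (X \<subseteq> S F \<and> ind X) \<and> card X = d"
      and bz: "\<And>G. chain_boundary V z G = 0"
    obtain C where C: "C \<in> \<C>" "F \<subseteq> C"
      using F by (auto simp: \<K>_def)
    have "F \<noteq> {}"
      using F(2) by auto
    then obtain B where B: "B \<subseteq> S F" "ind B" "card B = k"
      using S_rank[OF C] by blast
    \<comment> \<open>A face of a simplex has at most \<open>k\<close> vertices, so the cycle to be
      filled has dimension below the top dimension \<open>k - 1\<close> of the complex.\<close>
    have "Suc d \<le> card B"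
      using card_mono[OF fin_simplex[OF C(1)] C(2)] card_simplex[OF C(1)] F(2) B(3) by simp
    then obtain B' where B': "B' \<subseteq> B" "card B' = Suc d"
      by (meson obtain_subset_with_card_n)
    show "\<exists>c. (\<forall>X. c X \<noteq> 0 \<longrightarrow> (X \<subseteq> S F \<and> ind X) \<and> card X = Suc d) \<and> (\<forall>G. chain_boundary V c G = z G)"
    proof (rule matroid_complex_acyclic[OF M.matroid_restriction[OF S_sub] finV _ _ B'(2) z bz])
      show "S F \<subseteq> V"
        using S_sub by (auto simp: V_def)
      show "B' \<subseteq> S F \<and> ind B'"
        using B B' M.indep_subset by auto
    qed
  next
    show "X \<subseteq> S F \<and> ind X" if "X \<subseteq> S (F - {v}) \<and> ind X" for F v X
      using that S_mono[of "F - {v}" F] by auto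
  qed (use finV K_fin K_closed M.indep_empty in auto)

  \<comment> \<open>The identity of the triangulation, regarded as a chain map into sets of
    names.\<close>
  define \<psi> :: "'a set \<Rightarrow> 'v set \<Rightarrow> bit" where "\<psi> F X = of_bool (X = \<iota> ` F)" for F X
  have \<psi>_bd: "chain_boundary V (\<psi> F) G = (\<Sum>v\<in>F. \<psi> (F - {v}) G)" if "F \<in> \<K>" for F G
    using chain_boundary_simplex[OF finV inj_\<iota>[OF K_sub[OF that]] K_fin[OF that] K_V[OF that]]
    unfolding \<psi>_def by blast
  \<comment> \<open>The vertices whose points lie in every face of \<open>P\<close> that contains
    \<open>F\<close>. A homotopy carried by \<open>M\<close> is one relative to the faces.\<close>
  define M where "M F = {v \<in> V. \<forall>\<tau>. \<tau> face_of P \<longrightarrow> F \<subseteq> \<tau> \<longrightarrow> \<pi> v \<in> \<tau>}" for F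
  obtain h where h_empty: "\<And>X. h {} X = 0"
    and h_supp: "\<And>F X. F \<in> \<K> \<Longrightarrow> h F X \<noteq> 0 \<Longrightarrow> finite X \<and> X \<subseteq> M F \<and> card X = Suc (card F)"
    and h_bd: "\<And>F G. F \<in> \<K> \<Longrightarrow>
        chain_boundary V (h F) G = (\<phi> F G + \<psi> F G) + (\<Sum>v\<in>F. h (F - {v}) G)"
  proof (rule chain_null_homotopy[of V \<K> M "\<lambda>F X. \<phi> F X + \<psi> F X"])
    show "M F \<inter> V \<noteq> {}" if F: "F \<in> \<K>" "F \<noteq> {}" for F
    proof -
      obtain v where v: "v \<in> F"
        using F by auto
      have "\<pi> (\<iota> v) = v"
        using v K_sub[OF F(1)] by (intro \<iota>) blast
      then have "\<iota> v \<in> M F \<inter> V"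
        using v K_V[OF F(1)] by (auto simp: M_def)
      then show ?thesis by blast
    qed
    show "M (F - {v}) \<subseteq> M F" for F v
      by (auto simp: M_def)
    show "\<phi> {} X + \<psi> {} X = 0" for X
      by (simp add: \<phi>_empty \<psi>_def bit_add_self)
    show "finite X \<and> X \<subseteq> M F \<and> card X = card F" if F: "F \<in> \<K>" "\<phi> F X + \<psi> F X \<noteq> 0" for F X
    proof (cases "\<phi> F X = 0")
      case True
      then have X: "X = \<iota> ` F"
        using F(2) by (simp add: \<psi>_def split: if_splits)
      have "\<pi> (\<iota> v) = v" if "v \<in> F" for v
        using that K_sub[OF F(1)] by (intro \<iota>) blast
      then have "X \<subseteq> M F"
        using X K_V[OF F(1)] by (auto simp: M_def)
      then show ?thesis
        using X K_fin[OF F(1)] card_image[OF inj_\<iota>[OF K_sub[OF F(1)]]] by simp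
    next
      case False
      then have X: "X \<subseteq> S F" "ind X" "card X = card F"
        using \<phi>_supp[OF F(1)] by auto
      then have "X \<subseteq> M F"
        using S_face S_sub[of F] by (auto simp: M_def V_def)
      then show ?thesis
        using X M.finite_indep by auto
    qed
    show "chain_boundary V (\<lambda>X. \<phi> F X + \<psi> F X) G = (\<Sum>v\<in>F. \<phi> (F - {v}) G + \<psi> (F - {v}) G)"
      if "F \<in> \<K>" for F G
      using that by (simp add: chain_boundary_add \<phi>_bd \<psi>_bd sum.distrib)
  qed (use finV K_fin K_closed in auto)

  \<comment> \<open>The sets counted in the parity argument; \<open>N c\<close> below is the number
    modulo 2 of such sets in the chain \<open>c\<close>.\<close>
  define \<P> where "\<P> = {X. X \<subseteq> V \<and> card X = k \<and> q \<in> convex hull (\<pi> ` X)}"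
  have \<P>_sub: "\<P> \<subseteq> Pow V"
    by (auto simp: \<P>_def)
  define N where "N c = (\<Sum>X\<in>\<P>. c X)" for c :: "'v set \<Rightarrow> bit"
  have C_K: "C \<in> \<K>" if "C \<in> \<C>" for C
    using that by (auto simp: \<K>_def)

  \<comment> \<open>Each set in \<open>h C\<close> has \<open>k + 1\<close> elements, and an even
    number of its facets cover \<open>q\<close>; double counting gives zero.\<close>
  have N_boundary: "N (chain_boundary V (h C)) = 0" if C: "C \<in> \<C>" for C
  proof -
    have "(\<Sum>x\<in>D. if D - {x} \<in> \<P> then h C D else 0) = 0" if D: "D \<in> Pow V" for D
    proof (cases "h C D = 0")
      case False
      then have hD: "h C D = 1" and "finite D" and D_card: "card D = Suc k"
        using h_supp[OF C_K[OF C]] card_simplex[OF C] by auto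
      have "even (card {x \<in> D. q \<in> convex hull (\<pi> ` (D - {x}))})"
      proof (rule even_card_facets_covering_generic_point[OF \<open>finite D\<close> D_card _ aff_dim_P])
        show "\<pi> ` D \<subseteq> affine hull P"
          using D \<pi>V hull_subset[of P affine] by blast
        show "q \<notin> convex hull (\<pi> ` G)" if "G \<subseteq> D" "card G < k" for G
          using generic[of G] that D by (auto simp: V_def)
      qed
      moreover have "{x \<in> D. q \<in> convex hull (\<pi> ` (D - {x}))} = {x \<in> D. D - {x} \<in> \<P>}"
        using D D_card \<open>finite D\<close> by (auto simp: \<P>_def)
      ultimately have "even (card {x \<in> D. D - {x} \<in> \<P>})"
        by simp
      moreover have "(\<Sum>x\<in>D. if D - {x} \<in> \<P> then h C D else 0) = of_nat (card {x \<in> D. D - {x} \<in> \<P>})"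
        using \<open>finite D\<close> by (simp add: hD sum.inter_filter[symmetric])
      ultimately show ?thesis
        by (simp add: even_of_nat_bit)
    qed (simp cong: if_cong)
    then show ?thesis
      unfolding N_def sum_chain_boundary[OF finV \<P>_sub] by (rule sum.neutral[OF ballI])
  qed
  have N_split: "N (\<phi> C) + N (\<psi> C) + (\<Sum>v\<in>C. N (h (C - {v}))) = 0" if C: "C \<in> \<C>" for C
  proof -
    have "N (chain_boundary V (h C)) = N (\<phi> C) + N (\<psi> C) + (\<Sum>v\<in>C. N (h (C - {v})))"
      unfolding N_def h_bd[OF C_K[OF C]] by (simp add: sum.distrib sum.swap[of _ \<P> C])
    then show ?thesis
      using N_boundary[OF C] by simp
  qed
  \<comment> \<open>Regrouped by ridges, the term of \<open>G\<close> occurs once for each coface.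
    Interior ridges have evenly many cofaces; for a ridge in a proper face the homotopy stays in
    that face, which misses \<open>q\<close>.\<close>
  have ridges: "(\<Sum>C\<in>\<C>. \<Sum>v\<in>C. N (h (C - {v}))) = 0"
  proof -
    define R where "R = {G \<in> \<K>. Suc (card G) = k}"
    have finR: "finite R"
      using finite_subset[of R "Pow (\<Union>\<C>)"] K_sub finite_simplices fin_simplex by (auto simp: R_def)
    have "(\<Sum>C\<in>\<C>. \<Sum>v\<in>C. N (h (C - {v}))) = (\<Sum>(C, v)\<in>(SIGMA C:\<C>. C). N (h (C - {v})))"
      using finite_simplices fin_simplex by (intro sum.Sigma) auto
    also have "\<dots> = (\<Sum>(G, C)\<in>(SIGMA G:R. {C \<in> \<C>. G \<subseteq> C}). N (h G))"
    proof (rule sum.reindex_bij_witness[of _ "\<lambda>(G, C). (C, THE v. v \<in> C - G)" "\<lambda>(C, v). (C - {v}, C)"])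
      fix a assume a: "a \<in> (SIGMA C:\<C>. C)"
      then obtain C v where Cv: "a = (C, v)" "C \<in> \<C>" "v \<in> C"
        by auto
      have "(THE u. u \<in> C - (C - {v})) = v"
        using Cv by (intro the_equality) auto
      then show "(case case a of (C, v) \<Rightarrow> (C - {v}, C) of (G, C) \<Rightarrow> (C, THE v. v \<in> C - G)) = a"
        using Cv by simp
      have "Suc (card (C - {v})) = k"
        using card_Suc_Diff1[OF fin_simplex[OF Cv(2)] Cv(3)] card_simplex[OF Cv(2)] by simp
      then have "C - {v} \<in> R"
        using Cv K_closed[OF C_K[OF Cv(2)]] unfolding R_def by blast
      then show "(case a of (C, v) \<Rightarrow> (C - {v}, C)) \<in> (SIGMA G:R. {C \<in> \<C>. G \<subseteq> C})"
        using Cv by auto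
      show "(case case a of (C, v) \<Rightarrow> (C - {v}, C) of (G, C) \<Rightarrow> N (h G)) = (case a of (C, v) \<Rightarrow> N (h (C - {v})))"
        using Cv by simp
    next
      fix b assume "b \<in> (SIGMA G:R. {C \<in> \<C>. G \<subseteq> C})"
      then obtain G C where GC: "b = (G, C)" "G \<in> R" "C \<in> \<C>" "G \<subseteq> C"
        by auto
      obtain v where v: "v \<notin> G" "C = insert v G"
        using coface_eq_insert[OF GC(3,4)] GC(2) by (auto simp: R_def)
      have the_v: "(THE u. u \<in> C - G) = v"
        using v by (intro the_equality) auto
      show "(case case b of (G, C) \<Rightarrow> (C, THE v. v \<in> C - G) of (C, v) \<Rightarrow> (C - {v}, C)) = b"
        using GC(1) the_v v by simp
      show "(case b of (G, C) \<Rightarrow> (C, THE v. v \<in> C - G)) \<in> (SIGMA C:\<C>. C)"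
        using GC(1,3) the_v v by auto
    qed
    also have "\<dots> = (\<Sum>G\<in>R. \<Sum>C\<in>{C \<in> \<C>. G \<subseteq> C}. N (h G))"
      using finR finite_simplices by (intro sum.Sigma[symmetric]) auto
    also have "\<dots> = 0"
    proof (rule sum.neutral, rule ballI)
      fix G assume "G \<in> R"
      then have G: "G \<in> \<K>" "Suc (card G) = k"
        by (auto simp: R_def)
      consider "G = {}" | \<tau> where "\<tau> face_of P" "\<tau> \<noteq> P" "G \<subseteq> \<tau>"
        | "G \<noteq> {}" "\<And>\<tau>. \<tau> face_of P \<Longrightarrow> G \<subseteq> \<tau> \<Longrightarrow> \<tau> = P"
        by blast
      then show "(\<Sum>C\<in>{C \<in> \<C>. G \<subseteq> C}. N (h G)) = 0"
      proof cases
        \<comment> \<open>The empty ridge arises only for \<open>k = 1\<close>, and the homotopy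
          vanishes on it.\<close>
        case 1
        then have "N (h G) = 0"
          by (simp add: N_def h_empty)
        then show ?thesis by simp
      next
        case 2
        have "h G X = 0" if X: "X \<in> \<P>" for X
        proof (rule ccontr)
          assume "h G X \<noteq> 0"
          then have "\<pi> ` X \<subseteq> \<tau>"
            using h_supp[OF G(1)] 2 by (auto simp: M_def)
          then have "convex hull (\<pi> ` X) \<subseteq> \<tau>"
            using face_of_imp_convex[OF 2(1)] by (simp add: hull_minimal)
          then show False
            using X q(2)[OF 2(1,2)] by (auto simp: \<P>_def)
        qed
        then have "N (h G) = 0"
          by (simp add: N_def)
        then show ?thesis by simp
      next
        case 3
        then have "even (card {C \<in> \<C>. G \<subseteq> C})"
          using even_card_cofaces G(2) by blast
        then show ?thesis
          by (simp add: even_of_nat_bit)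
      qed
    qed
    finally show ?thesis .
  qed
  \<comment> \<open>Exactly one simplex contains \<open>q\<close>: two different ones would have
    \<open>q\<close> in the hull of their fewer than \<open>k\<close> common vertices.\<close>
  have one: "(\<Sum>C\<in>\<C>. N (\<psi> C)) = 1"
  proof -
    obtain C0 where C0: "C0 \<in> \<C>" "q \<in> convex hull C0"
      using q(1) simplices_cover by blast
    have N\<psi>: "N (\<psi> C) = of_bool (C = C0)" if C: "C \<in> \<C>" for C
    proof -
      have sub: "C \<subseteq> \<Union>\<C>"
        using C by auto
      have "N (\<psi> C) = (\<Sum>X\<in>\<P>. if X = \<iota> ` C then 1 else 0)"
        by (simp add: N_def \<psi>_def of_bool_def)
      also have "\<dots> = of_bool (\<iota> ` C \<in> \<P>)"
        using finite_subset[OF \<P>_sub] finV by simp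
      also have "\<iota> ` C \<in> \<P> \<longleftrightarrow> q \<in> convex hull C"
        using K_V[OF C_K[OF C]] card_image[OF inj_\<iota>[OF sub]] card_simplex[OF C] \<pi>\<iota>[OF sub]
        by (simp add: \<P>_def)
      also have "\<dots> \<longleftrightarrow> C = C0"
      proof
        assume "q \<in> convex hull C"
        then have "q \<in> convex hull (C \<inter> C0)"
          using hull_Int[OF C C0(1)] C0(2) by blast
        moreover have "\<pi> ` \<iota> ` (C \<inter> C0) = C \<inter> C0"
          using sub by (intro \<pi>\<iota>) blast
        ultimately have "q \<in> convex hull (\<pi> ` \<iota> ` (C \<inter> C0))"
          by simp
        then have "\<not> card (\<iota> ` (C \<inter> C0)) < k"
          using generic[of "\<iota> ` (C \<inter> C0)"] sub by blast
        then have "k \<le> card (C \<inter> C0)"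
          using card_image_le[of "C \<inter> C0" \<iota>] fin_simplex[OF C] by (meson finite_Int le_trans linorder_not_less)
        then have "C \<inter> C0 = C" "C \<inter> C0 = C0"
          using card_seteq[of C "C \<inter> C0"] card_seteq[of C0 "C \<inter> C0"] fin_simplex C C0(1) card_simplex by auto
        then show "C = C0"
          by simp
      qed (use C0 in simp)
      finally show ?thesis .
    qed
    have "(\<Sum>C\<in>\<C>. N (\<psi> C)) = (\<Sum>C\<in>\<C>. if C = C0 then 1 else 0)"
      using N\<psi> by (intro sum.cong) auto
    then show ?thesis
      using C0 finite_simplices by simp
  qed
  have "(\<Sum>C\<in>\<C>. N (\<phi> C)) + (\<Sum>C\<in>\<C>. N (\<psi> C)) + (\<Sum>C\<in>\<C>. \<Sum>v\<in>C. N (h (C - {v}))) = 0"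
    unfolding sum.distrib[symmetric] using N_split by (intro sum.neutral) auto
  then have "(\<Sum>C\<in>\<C>. N (\<phi> C)) \<noteq> 0"
    using ridges one by (metis add_0 add.right_neutral zero_neq_one)
  then obtain C where C: "C \<in> \<C>" "N (\<phi> C) \<noteq> 0"
    by (rule sum.not_neutral_contains_not_neutral)
  obtain X where X: "X \<in> \<P>" "\<phi> C X \<noteq> 0"
    using C(2) unfolding N_def by (rule sum.not_neutral_contains_not_neutral)
  then have "X \<subseteq> S C" "ind X" "card X = k" "q \<in> convex hull (\<pi> ` X)"
    using \<phi>_supp[OF C_K[OF C(1)] X(2)] card_simplex[OF C(1)] by (auto simp: \<P>_def)
  then show ?thesis
    using C(1) by blast
qed

end

subsection \<open>Colorful covers\<close>

text \<open>Every element of the matroid is replaced by parallel copies, the fibre of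
  \<open>f\<close> over it. Injectivity of \<open>f\<close> allows at most one copy of each, which
  is how the chosen colors become distinct.\<close>

lemma (in matroid) matroid_parallel_extension:
  assumes "finite E" "f ` E \<subseteq> W"
  shows "matroid E (\<lambda>X. X \<subseteq> E \<and> inj_on f X \<and> indep (f ` X))"
proof
  show "\<exists>y\<in>Y - X. insert y X \<subseteq> E \<and> inj_on f (insert y X) \<and> indep (f ` insert y X)"
    if X: "X \<subseteq> E \<and> inj_on f X \<and> indep (f ` X)" and Y: "Y \<subseteq> E \<and> inj_on f Y \<and> indep (f ` Y)"
      and XY: "card X < card Y" for X Y
  proof -
    have "card (f ` X) < card (f ` Y)"
      using X Y XY by (simp add: card_image)
    then obtain w where w: "w \<in> f ` Y - f ` X" "indep (insert w (f ` X))"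
      using augmentation[of "f ` X" "f ` Y"] X Y by blast
    then obtain y where y: "y \<in> Y" "w = f y"
      by blast
    then have "y \<in> Y - X" "insert y X \<subseteq> E" "inj_on f (insert y X)" "indep (f ` insert y X)"
      using w X Y by auto
    then show ?thesis
      by blast
  qed
  show "Y \<subseteq> E \<and> inj_on f Y \<and> indep (f ` Y)" if "X \<subseteq> E \<and> inj_on f X \<and> indep (f ` X)" "Y \<subseteq> X" for X Y
    using that indep_subset[of "f ` X" "f ` Y"] inj_on_subset[of f X Y] by auto
qed (use assms indep_empty in auto)

lemma (in matroid) finite_card_indep_subsets: "finite (card ` {X. X \<subseteq> T \<and> indep X})"
proof -
  have "{X. X \<subseteq> T \<and> indep X} \<subseteq> Pow W"
    using indep_subset_ground by auto
  then show ?thesis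
    using finite_ground finite_subset by (intro finite_imageI) blast
qed

lemma (in matroid) indep_of_card_le_rank:
  assumes "k \<le> matroid_rank indep T"
  obtains X where "X \<subseteq> T" "indep X" "card X = k"
proof -
  have "matroid_rank indep T \<in> card ` {X. X \<subseteq> T \<and> indep X}"
    unfolding matroid_rank_def using indep_empty by (intro Max_in finite_card_indep_subsets) blast
  then obtain X where X: "X \<subseteq> T" "indep X" "k \<le> card X"
    using assms by auto
  then obtain Y where "Y \<subseteq> X" "card Y = k"
    by (meson obtain_subset_with_card_n)
  then show thesis
    using that X indep_subset by blast
qed

text \<open>Applying the covering condition to the complement of the set of colors available at \<open>x\<close>
  shows that these colors span the matroid.\<close>

lemma matroid_komiya_cover_spanning:
  assumes "matroid W indep" "matroid_rank indep W = k" "matroid_komiya_cover W indep P A"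
    and "\<tau> \<in> nonempty_faces P" "x \<in> \<tau>"
  obtains B where "indep B" "card B = k"
    and "\<And>w. w \<in> B \<Longrightarrow> w \<in> W \<and> (\<exists>\<sigma>\<in>nonempty_faces P. \<sigma> \<subseteq> \<tau> \<and> x \<in> A w \<sigma>)"
proof -
  interpret matroid W indep by (rule assms(1))
  define L where "L = {w \<in> W. \<exists>\<sigma>\<in>nonempty_faces P. \<sigma> \<subseteq> \<tau> \<and> x \<in> A w \<sigma>}"
  have "k \<le> matroid_rank indep L"
  proof (rule ccontr)
    assume "\<not> k \<le> matroid_rank indep L"
    moreover have "W - (W - L) = L"
      by (auto simp: L_def)
    ultimately have "int (matroid_rank indep (W - (W - L))) \<le> int (matroid_rank indep W) - 1"
      using assms(2) by simp
    then have "komiya_cover P (\<lambda>\<sigma>. \<Union>w\<in>W - L. A w \<sigma>)"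
      using assms(3) unfolding matroid_komiya_cover_def by blast
    then have "x \<in> (\<Union>\<sigma>\<in>{\<sigma> \<in> nonempty_faces P. \<sigma> \<subseteq> \<tau>}. \<Union>w\<in>W - L. A w \<sigma>)"
      using assms(4,5) unfolding komiya_cover_def by blast
    then show False
      by (auto simp: L_def)
  qed
  then obtain B where "B \<subseteq> L" "indep B" "card B = k"
    by (rule indep_of_card_le_rank)
  then show thesis
    using that[of B] by (auto simp: L_def)
qed

lemma finite_nonempty_faces: "polytope P \<Longrightarrow> finite (nonempty_faces P)"
  using finite_polytope_faces[of P] finite_subset[of "nonempty_faces P" "{F. F face_of P}"]
  by (auto simp: nonempty_faces_def)

text \<open>The labels are the pairs \<open>(w, \<sigma>)\<close>, treated as parallel copies of the
  color \<open>w\<close>. Since the simplices have diameter below \<open>e\<close>, any vertex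
  \<open>x\<close> of the simplex found is close to all the sets \<open>A w \<sigma>\<close> of its
  labels.\<close>

lemma approximate_colorful_cover:
  fixes P :: "'a::euclidean_space set" and y :: "'w \<Rightarrow> 'a set \<Rightarrow> 'a"
  assumes "k \<ge> 1" and P: "polytope P" "aff_dim P = int k - 1" and "p \<in> P"
    and M: "matroid W indep" "matroid_rank indep W = k"
    and y: "\<forall>w\<in>W. \<forall>\<sigma>\<in>nonempty_faces P. y w \<sigma> \<in> \<sigma>"
    and cover: "matroid_komiya_cover W indep P A" and "0 < e"
  shows "\<exists>J q x. J \<subseteq> W \<times> nonempty_faces P \<and> inj_on fst J \<and> indep (fst ` J) \<and> card J = k \<and>
    dist q p < e \<and> q \<in> convex hull ((\<lambda>(w, \<sigma>). y w \<sigma>) ` J) \<and>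
    x \<in> P \<and> (\<forall>(w, \<sigma>)\<in>J. \<exists>v\<in>A w \<sigma>. dist v x < e)"
proof -
  interpret M: matroid W indep by (rule M(1))
  obtain \<C> where triangulation: "simplex_triangulation P k \<C>"
    and mesh: "\<And>C x y. C \<in> \<C> \<Longrightarrow> x \<in> C \<Longrightarrow> y \<in> C \<Longrightarrow> dist x y < e"
    using polytope_fine_triangulation[OF P \<open>0 < e\<close>] by metis
  interpret simplex_triangulation P k \<C> by (rule triangulation)
  \<comment> \<open>\<open>Inl\<close> marks the labels and \<open>Inr\<close> the vertices of the triangulation.\<close>
  define E :: "('w \<times> 'a set + 'a) set" where "E = Inl ` (W \<times> nonempty_faces P)"
  define f :: "'w \<times> 'a set + 'a \<Rightarrow> 'w" where "f = fst \<circ> projl"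
  define \<pi> :: "'w \<times> 'a set + 'a \<Rightarrow> 'a" where "\<pi> = case_sum (\<lambda>(w, \<sigma>). y w \<sigma>) id"
  \<comment> \<open>The condition on faces says that \<open>\<sigma>\<close> lies in the smallest
    face of \<open>P\<close> containing \<open>F\<close>. It makes \<open>S\<close> monotone and
    keeps \<open>y w \<sigma>\<close> in every face containing \<open>F\<close>.\<close>
  define S :: "'a set \<Rightarrow> ('w \<times> 'a set + 'a) set" where "S F = Inl ` {(w, \<sigma>). w \<in> W \<and> \<sigma> \<in> nonempty_faces P \<and> (\<exists>v\<in>F. v \<in> A w \<sigma>) \<and>
      (\<forall>\<tau>. \<tau> face_of P \<longrightarrow> F \<subseteq> \<tau> \<longrightarrow> \<sigma> \<subseteq> \<tau>)}" for F
  define ind where "ind X \<longleftrightarrow> X \<subseteq> E \<and> inj_on f X \<and> indep (f ` X)" for X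
  have finE: "finite E"
    unfolding E_def using M.finite_ground finite_nonempty_faces[OF P(1)] by simp
  define V where "V = E \<union> Inr ` \<Union>\<C>"
  have finV: "finite V"
    unfolding V_def using finE finite_simplices aff_independent_finite[OF indep_simplex] by auto
  have convP: "convex P" "closed P"
    using P(1) by (auto simp: polytope_imp_convex polytope_imp_closed)
  define \<A> where "\<A> = (\<lambda>G. convex hull (\<pi> ` G)) ` {G. G \<subseteq> V \<and> card G < k} \<union> {\<tau>. \<tau> face_of P \<and> \<tau> \<noteq> P}"
  obtain q where q: "q \<in> P" "dist q p < e" and q_generic: "\<And>T. T \<in> \<A> \<Longrightarrow> q \<notin> T"
  proof (rule generic_point_near[OF convP(2,1) _ \<open>p \<in> P\<close> \<open>0 < e\<close>, of \<A>])
    show "finite \<A>"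
      unfolding \<A>_def using finV finite_subset[OF _ finite_polytope_faces[OF P(1)]] by auto
    show "closed T \<and> convex T \<and> aff_dim T < aff_dim P" if T: "T \<in> \<A>" for T
    proof -
      consider G where "G \<subseteq> V" "card G < k" "T = convex hull (\<pi> ` G)" | "T face_of P" "T \<noteq> P"
        using T by (auto simp: \<A>_def)
      then show ?thesis
      proof cases
        case 1
        have fin: "finite (\<pi> ` G)"
          using finite_subset[OF 1(1) finV] by simp
        then have "closed T"
          using 1 by (simp add: finite_imp_compact_convex_hull compact_imp_closed)
        moreover have "aff_dim T \<le> int (card (\<pi> ` G)) - 1"
          using 1 aff_dim_le_card[OF fin] by (simp add: aff_dim_convex_hull)
        moreover have "card (\<pi> ` G) \<le> card G"
          using finite_subset[OF 1(1) finV] by (rule card_image_le)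
        ultimately show ?thesis
          using 1 P(2) by simp
      next
        case 2
        then show ?thesis
          using convP face_of_imp_closed face_of_imp_convex face_of_aff_dim_lt by blast
      qed
    qed
  qed blast
  have "\<exists>C\<in>\<C>. \<exists>I\<subseteq>S C. ind I \<and> card I = k \<and> q \<in> convex hull (\<pi> ` I)"
  proof (rule independent_set_covering_generic_point)
    show "matroid E ind"
      unfolding ind_def using finE by (intro M.matroid_parallel_extension) (auto simp: E_def f_def)
    show "\<pi> ` E \<subseteq> P"
    proof
      fix z assume "z \<in> \<pi> ` E"
      then obtain w \<sigma> where "w \<in> W" "\<sigma> \<in> nonempty_faces P" "z = y w \<sigma>"
        by (auto simp: E_def \<pi>_def)
      then have "z \<in> \<sigma>" "\<sigma> face_of P"
        using y by (auto simp: nonempty_faces_def)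
      then show "z \<in> P"
        using face_of_imp_subset by blast
    qed
    show "\<pi> (Inr x) = x" for x
      by (simp add: \<pi>_def)
    show "S F \<subseteq> E" for F
      by (auto simp: S_def E_def)
    show "S G \<subseteq> S F" if "G \<subseteq> F" for F G
      unfolding S_def using that by (intro image_mono) auto
    show "\<exists>B\<subseteq>S F. ind B \<and> card B = k" if F: "C \<in> \<C>" "F \<subseteq> C" "F \<noteq> {}" for C F
    proof -
      obtain v where v: "v \<in> F"
        using F by blast
      \<comment> \<open>In the smallest face containing \<open>F\<close>, the colors available at
        the single vertex \<open>v\<close> already span the matroid.\<close>
      define \<tau> where "\<tau> = \<Inter>{\<tau>. \<tau> face_of P \<and> F \<subseteq> \<tau>}"
      have "P \<in> {\<tau>. \<tau> face_of P \<and> F \<subseteq> \<tau>}"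
        using face_of_refl[OF convP(1)] simplex_subset F by blast
      then have "\<tau> face_of P"
        unfolding \<tau>_def by (intro face_of_Inter) blast+
      moreover have v\<tau>: "v \<in> \<tau>"
        using v by (auto simp: \<tau>_def)
      ultimately have \<tau>: "\<tau> \<in> nonempty_faces P"
        by (auto simp: nonempty_faces_def)
      obtain B where B: "indep B" "card B = k"
        and B_faces: "\<And>w. w \<in> B \<Longrightarrow> w \<in> W \<and> (\<exists>\<sigma>\<in>nonempty_faces P. \<sigma> \<subseteq> \<tau> \<and> v \<in> A w \<sigma>)"
        using matroid_komiya_cover_spanning[OF M cover \<tau> v\<tau>] by blast
      then obtain s where s: "\<And>w. w \<in> B \<Longrightarrow> s w \<in> nonempty_faces P \<and> s w \<subseteq> \<tau> \<and> v \<in> A w (s w)"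
        by metis
      define B' :: "('w \<times> 'a set + 'a) set" where "B' = (\<lambda>w. Inl (w, s w)) ` B"
      have "f ` B' = B"
        by (force simp: B'_def f_def)
      moreover have "inj_on f B'"
        by (auto simp: inj_on_def B'_def f_def)
      moreover have "B' \<subseteq> S F"
        using s B_faces v by (fastforce simp: B'_def S_def \<tau>_def)
      moreover have "B' \<subseteq> E"
        using s B_faces by (auto simp: B'_def E_def)
      ultimately show ?thesis
        using B card_image[of f B'] unfolding ind_def by auto
    qed
    show "\<pi> e \<in> \<tau>" if e: "e \<in> S F" "\<tau> face_of P" "F \<subseteq> \<tau>" for F e \<tau>
    proof -
      obtain w \<sigma> where "e = Inl (w, \<sigma>)" "w \<in> W" "\<sigma> \<in> nonempty_faces P"
        and "\<And>\<tau>. \<tau> face_of P \<Longrightarrow> F \<subseteq> \<tau> \<Longrightarrow> \<sigma> \<subseteq> \<tau>"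
        using e(1) by (auto simp: S_def)
      moreover from this have "y w \<sigma> \<in> \<sigma>"
        using y by blast
      ultimately show ?thesis
        using e(2,3) by (auto simp: \<pi>_def)
    qed
    show "q \<in> P"
      by (rule q)
    show "q \<notin> \<tau>" if "\<tau> face_of P" "\<tau> \<noteq> P" for \<tau>
      using q_generic that by (auto simp: \<A>_def)
    show "q \<notin> convex hull (\<pi> ` G)" if "G \<subseteq> E \<union> Inr ` \<Union>\<C>" "card G < k" for G
      using q_generic that unfolding \<A>_def V_def by blast
  qed
  then obtain C I where C: "C \<in> \<C>" and I: "I \<subseteq> S C" "ind I" "card I = k" "q \<in> convex hull (\<pi> ` I)"
    by blast
  define J where "J = projl ` I"
  have I_eq: "I = Inl ` J"
    using I(1) by (force simp: J_def S_def image_iff)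
  have J: "w \<in> W" "\<sigma> \<in> nonempty_faces P" "\<exists>v\<in>C. v \<in> A w \<sigma>" if "(w, \<sigma>) \<in> J" for w \<sigma>
    using I(1) that by (auto simp: I_eq S_def)
  have "C \<noteq> {}"
    using card_simplex[OF C] \<open>k \<ge> 1\<close> by auto
  then obtain x where x: "x \<in> C"
    by blast
  have near: "\<exists>v\<in>A w \<sigma>. dist v x < e" if "(w, \<sigma>) \<in> J" for w \<sigma>
    using J(3)[OF that] mesh[OF C _ x] by blast
  show ?thesis
  proof (intro exI conjI)
    show "J \<subseteq> W \<times> nonempty_faces P"
      using J by auto
    show "inj_on fst J"
      using I(2) by (auto simp: ind_def I_eq f_def inj_on_def)
    show "indep (fst ` J)"
      using I(2) by (simp add: ind_def I_eq f_def image_image)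
    show "card J = k"
      using I(3) by (simp add: I_eq card_image)
    show "q \<in> convex hull ((\<lambda>(w, \<sigma>). y w \<sigma>) ` J)"
      using I(4) by (simp add: I_eq \<pi>_def image_image)
    show "x \<in> P"
      using x C simplex_subset by blast
    show "\<forall>(w, \<sigma>)\<in>J. \<exists>v\<in>A w \<sigma>. dist v x < e"
      using near by blast
  qed (rule q)
qed

section \<open>Passage to the limit by compactness\<close>

text \<open>The sum of the distances to the sets \<open>A j\<close> is continuous and attains its
  minimum on \<open>P\<close>; points near all the sets show that this minimum is zero.\<close>

lemma compact_common_point:
  fixes P :: "'a::euclidean_space set"
  assumes "compact P" "finite J" and A: "\<And>j. j \<in> J \<Longrightarrow> closed (A j)"
    and near: "\<And>e. 0 < e \<Longrightarrow> \<exists>x\<in>P. \<forall>j\<in>J. \<exists>v\<in>A j. dist v x < e"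
  obtains x where "x \<in> P" "\<And>j. j \<in> J \<Longrightarrow> x \<in> A j"
proof -
  \<comment> \<open>\<open>infdist\<close> to the empty set is 0 by convention, so distance zero
    means membership only for nonempty closed sets.\<close>
  have nonempty: "A j \<noteq> {}" if "j \<in> J" for j
    using near[of 1] that by auto
  have "P \<noteq> {}"
    using near[of 1] by auto
  moreover have "continuous_on P (\<lambda>x. \<Sum>j\<in>J. infdist x (A j))"
    by (intro continuous_intros)
  ultimately obtain x0 where x0: "x0 \<in> P"
      "\<And>x. x \<in> P \<Longrightarrow> (\<Sum>j\<in>J. infdist x0 (A j)) \<le> (\<Sum>j\<in>J. infdist x (A j))"
    using continuous_attains_inf[OF \<open>compact P\<close>] by blast
  have "(\<Sum>j\<in>J. infdist x0 (A j)) \<le> 0 + e" if "0 < e" for e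
  proof -
    define d where "d = e / (1 + real (card J))"
    have "d > 0"
      using that by (simp add: d_def add_pos_nonneg)
    then obtain x where x: "x \<in> P" "\<And>j. j \<in> J \<Longrightarrow> \<exists>v\<in>A j. dist v x < d"
      using near by blast
    have "infdist x (A j) \<le> d" if "j \<in> J" for j
    proof -
      obtain v where "v \<in> A j" "dist v x < d"
        using x(2)[OF \<open>j \<in> J\<close>] by blast
      then show ?thesis
        using infdist_le[of v "A j" x] by (simp add: dist_commute)
    qed
    then have "(\<Sum>j\<in>J. infdist x (A j)) \<le> real (card J) * d"
      using sum_bounded_above[of J "\<lambda>j. infdist x (A j)" d] by simp
    also have "\<dots> \<le> (1 + real (card J)) * d"
      using \<open>d > 0\<close> by (simp add: algebra_simps)
    also have "\<dots> = e"
      by (simp add: d_def add_nonneg_eq_0_iff)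
    finally show ?thesis
      using x0(2)[OF x(1)] by linarith
  qed
  then have "(\<Sum>j\<in>J. infdist x0 (A j)) \<le> 0"
    by (rule field_le_epsilon)
  then have "infdist x0 (A j) = 0" if "j \<in> J" for j
    using sum_nonneg_eq_0_iff[OF \<open>finite J\<close>, of "\<lambda>j. infdist x0 (A j)"] that
    by (simp add: infdist_nonneg sum_nonneg order_antisym)
  then have "x0 \<in> A j" if "j \<in> J" for j
    using in_closed_iff_infdist_zero[OF A nonempty] that by blast
  then show thesis
    using that x0(1) by blast
qed

theorem mainTheorem1:
  fixes k :: nat
    and P :: "'a::euclidean_space set"
    and p :: 'a
    and W :: "'w set"
    and indep :: "'w set \<Rightarrow> bool"
    and y :: "'w \<Rightarrow> 'a set \<Rightarrow> 'a"
    and A :: "'w \<Rightarrow> 'a set \<Rightarrow> 'a set"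
  assumes "k \<ge> 1"
    and "polytope P"
    and "aff_dim P = int k - 1"
    and "p \<in> P"
    and "matroid W indep"
    and "matroid_rank indep W = k"
    and "\<And>w \<sigma>. w \<in> W \<Longrightarrow> \<sigma> \<in> nonempty_faces P \<Longrightarrow> y w \<sigma> \<in> \<sigma>"
    and "\<And>w \<sigma>. w \<in> W \<Longrightarrow> \<sigma> \<in> nonempty_faces P \<Longrightarrow> closed (A w \<sigma>) \<and> A w \<sigma> \<subseteq> P"
    and "matroid_komiya_cover W indep P A"
  shows "\<exists>(w :: nat \<Rightarrow> 'w) (\<sigma> :: nat \<Rightarrow> 'a set).
           inj_on w {1..k} \<and> matroid_basis W indep (w ` {1..k}) \<and>
           (\<forall>i\<in>{1..k}. \<sigma> i \<in> nonempty_faces P) \<and>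
           (\<Inter>i\<in>{1..k}. A (w i) (\<sigma> i)) \<noteq> {} \<and>
           p \<in> convex hull ((\<lambda>i. y (w i) (\<sigma> i)) ` {1..k})"
proof -
  interpret M: matroid W indep by (rule assms(5))
  let ?y = "\<lambda>(w, \<sigma>). y w \<sigma>"
  define Q where "Q e J \<longleftrightarrow> inj_on fst J \<and> indep (fst ` J) \<and> card J = k \<and>
      (\<exists>q\<in>convex hull (?y ` J). dist q p < e) \<and>
      (\<exists>x\<in>P. \<forall>(w, \<sigma>)\<in>J. \<exists>v\<in>A w \<sigma>. dist v x < e)" for e :: real and J
  define \<J> where "\<J> = Pow (W \<times> nonempty_faces P)"
  have fin: "finite \<J>"
    unfolding \<J>_def using M.finite_ground finite_nonempty_faces[OF assms(2)] by simp
  have y: "\<forall>w\<in>W. \<forall>\<sigma>\<in>nonempty_faces P. y w \<sigma> \<in> \<sigma>"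
    using assms(7) by blast
  have Q_ex: "\<exists>J\<in>\<J>. Q e J" if "0 < e" for e
  proof -
    obtain J q x where J: "J \<subseteq> W \<times> nonempty_faces P" "inj_on fst J" "indep (fst ` J)" "card J = k"
      and qx: "dist q p < e" "q \<in> convex hull (?y ` J)" "x \<in> P" "\<forall>(w, \<sigma>)\<in>J. \<exists>v\<in>A w \<sigma>. dist v x < e"
      using approximate_colorful_cover[OF assms(1-6) y assms(9) \<open>0 < e\<close>] by (elim exE conjE) (rule that)
    then have "Q e J"
      unfolding Q_def by (intro conjI bexI[of _ q] bexI[of _ x])
    then show ?thesis
      using J(1) unfolding \<J>_def by blast
  qed
  have Q_mono: "Q e' J" if Q: "Q e J" and "e \<le> e'" for e e' J
  proof -
    obtain q x where "q \<in> convex hull (?y ` J)" "dist q p < e" "x \<in> P"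
      and near: "\<And>w \<sigma>. (w, \<sigma>) \<in> J \<Longrightarrow> \<exists>v\<in>A w \<sigma>. dist v x < e"
      using Q unfolding Q_def by blast
    moreover have "\<exists>v\<in>A w \<sigma>. dist v x < e'" if "(w, \<sigma>) \<in> J" for w \<sigma>
      using near[OF that] \<open>e \<le> e'\<close> by (meson less_le_trans)
    moreover have "dist q p < e'"
      using \<open>dist q p < e\<close> \<open>e \<le> e'\<close> by simp
    ultimately show ?thesis
      using Q unfolding Q_def by blast
  qed
  \<comment> \<open>There are finitely many candidates \<open>J\<close>, and \<open>Q\<close> is
    monotone in the error \<open>e\<close>. If each candidate failed for some error, all would fail
    for the least of these errors.\<close>
  have "\<exists>J\<in>\<J>. \<forall>e>0. Q e J"
  proof (rule ccontr)
    assume "\<not> (\<exists>J\<in>\<J>. \<forall>e>0. Q e J)"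
    then obtain \<epsilon> where \<epsilon>: "\<And>J. J \<in> \<J> \<Longrightarrow> \<epsilon> J > 0 \<and> \<not> Q (\<epsilon> J) J"
      by metis
    define e where "e = Min (insert 1 (\<epsilon> ` \<J>))"
    have "e > 0"
      unfolding e_def using fin \<epsilon> by (subst Min_gr_iff) auto
    then obtain J where J: "J \<in> \<J>" "Q e J"
      using Q_ex by blast
    have "e \<le> \<epsilon> J"
      unfolding e_def using fin J(1) by (intro Min_le) auto
    then show False
      using Q_mono[OF J(2)] \<epsilon>[OF J(1)] by blast
  qed
  then obtain J where J: "J \<subseteq> W \<times> nonempty_faces P" and Q: "\<And>e. 0 < e \<Longrightarrow> Q e J"
    unfolding \<J>_def by blast
  have J_props: "inj_on fst J" "indep (fst ` J)" "card J = k"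
    using Q[of 1] unfolding Q_def by auto
  have finJ: "finite J"
    using J_props(3) assms(1) by (intro card_ge_0_finite) simp
  have "closed (convex hull (?y ` J))"
    using finJ by (simp add: finite_imp_compact_convex_hull compact_imp_closed)
  moreover have "p \<in> closure (convex hull (?y ` J))"
    unfolding closure_approachable using Q unfolding Q_def by blast
  ultimately have p: "p \<in> convex hull (?y ` J)"
    by (simp add: closure_closed)
  obtain x where x: "\<And>w \<sigma>. (w, \<sigma>) \<in> J \<Longrightarrow> x \<in> A w \<sigma>"
  proof (rule compact_common_point[OF polytope_imp_compact[OF assms(2)] finJ, of "\<lambda>(w, \<sigma>). A w \<sigma>"])
    show "closed (case j of (w, \<sigma>) \<Rightarrow> A w \<sigma>)" if "j \<in> J" for j
      using that J assms(8) by auto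
    show "\<exists>x\<in>P. \<forall>j\<in>J. \<exists>v\<in>case j of (w, \<sigma>) \<Rightarrow> A w \<sigma>. dist v x < e" if "0 < e" for e
      using Q[OF that] unfolding Q_def by (simp add: case_prod_beta)
  qed auto
  \<comment> \<open>Enumerating \<open>J\<close> turns its pairs into the two sequences;
    \<open>fst\<close> is injective on \<open>J\<close>, so the \<open>k\<close> colors are
    distinct.\<close>
  obtain b where b: "bij_betw b {1..k} J"
    using ex_bij_betw_nat_finite_1[OF finJ] J_props(3) by auto
  have bJ: "b ` {1..k} = J"
    using b by (rule bij_betw_imp_surj_on)
  show ?thesis
  proof (intro exI conjI)
    show "inj_on (fst \<circ> b) {1..k}"
      using comp_inj_on[of b "{1..k}" fst] b J_props(1) bJ by (simp add: bij_betw_def)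
    have "(fst \<circ> b) ` {1..k} = fst ` J"
      unfolding bJ[symmetric] by (rule image_comp[symmetric])
    then show "matroid_basis W indep ((fst \<circ> b) ` {1..k})"
      using J_props assms(6) by (simp add: matroid_basis_def card_image)
    show "\<forall>i\<in>{1..k}. (snd \<circ> b) i \<in> nonempty_faces P"
      using bJ J by fastforce
    have "x \<in> A ((fst \<circ> b) i) ((snd \<circ> b) i)" if "i \<in> {1..k}" for i
      using x[of "fst (b i)" "snd (b i)"] bJ that by auto
    then show "(\<Inter>i\<in>{1..k}. A ((fst \<circ> b) i) ((snd \<circ> b) i)) \<noteq> {}"
      by blast
    have "(\<lambda>i. y ((fst \<circ> b) i) ((snd \<circ> b) i)) ` {1..k} = ?y ` J"
      unfolding bJ[symmetric] image_image by (simp add: case_prod_beta)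
    then show "p \<in> convex hull ((\<lambda>i. y ((fst \<circ> b) i) ((snd \<circ> b) i)) ` {1..k})"
      using p by simp
  qed
qed

end
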